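(* Let the disclosed radial-qubit directions range over an equatorial projective circle, let the target be the binary entropy \[ s(t)=-\frac{1+t}2\log\frac{1+t}2-\frac{1-t}2\log\frac{1-t}2, \] and let $t_0\in[\tau,1-\tau]$ for fixed $0<\tau<1/2$. For every integer sequence $k_n\ge2$, with $H_n=n^{1/6}$, \[ F_{n,k_n}(H_n)=\operatorname{artanh}^2(t_0)\tan^2\!\Big(\frac{\pi}{2k_n}\Big)+O_\tau(n^{-1/3}), \] uniformly in $t_0$. Consequently, if $k_n\to\infty$ and $k_n=o(n^{1/6})$, then \[ \frac{F_{n,k_n}(n^{1/6})}{A_{k_n}}\longrightarrow1 . \]
   Context: A radial qubit state with disclosed direction $q\in\mathbb S^2$ and unknown radius $t$, measured along an unoriented axis $[a]\in\mathbb{RP}^2$, gives binary outcomes with (after relabeling outcomes using the known $q$) $\mathbb P(Y=y)=\{1+yct\}/2$, $y\in\{-1,1\}$, where $c=c(q,a)=|q^{\mathsf T}a|$. The contexts are $q\in\mathcal Q$ = a great circle (equator) of $\mathbb S^2$, considered modulo sign. Menus $V$ are nonempty finite sets of axes in $\mathbb{RP}^2$. For overlap $c\in(0,1]$ let $R^c_{n,H}(t_0,s)=\inf_T\sup_{|h|\le H}\mathbb E_{t_0+h/\sqrt n,c}\big[T-\sqrt n\{s(t_0+h/\sqrt n)-s(t_0)\}\big]^2$, the minimax risk over estimators based on $n$ independent observations with $t=t_0+h/\sqrt n$; for $c=0$ (uninformative) it is $\frac14$ times the squared range over $|h|\le H$ of $\sqrt n\{s(t_0+h/\sqrt n)-s(t_0)\}$.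 With $c_V(q)=\max_{a\in V}c(q,a)$, \[ F_{n,k}(H)=\inf_{1\le|V|\le k}\ \sup_{q\in\mathcal Q}\{R^{c_V(q)}_{n,H}(t_0,s)-R^1_{n,H}(t_0,s)\}, \] and $A_k=\inf_{1\le|V|\le k}\sup_{q\in\mathcal Q}\dot s(t_0)^2\{c_V(q)^{-2}-1\}$ is the fixed-menu frontier (with $0^{-2}=\infty$). $O_\tau$ means the implied constant depends only on $\tau$. *)

theory Defs
  imports "HOL-Probability.Probability" "HOL-Library.Landau_Symbols"
begin

quotient_type rp2 = "real ^ 3" / partial: "\<lambda>a b. norm a = 1 \<and> norm b = 1 \<and> (a = b \<or> a = - b)"
proof (rule part_equivpI)
  show "\<exists>x :: real ^ 3. norm x = 1 \<and> norm x = 1 \<and> (x = x \<or> x = - x)"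
    by (rule exI[of _ "axis 1 1"]) simp
qed (rule sympI transpI; (elim conjE disjE)?; simp)+

lift_definition overlap :: "rp2 \<Rightarrow> rp2 \<Rightarrow> real" is "\<lambda>q a. \<bar>q \<bullet> a\<bar>"
  by auto

text \<open>The great circle with unit normal \<open>p\<close>, modulo sign. The value of \<open>abs_rp2\<close> is
  meaningful on unit vectors only.\<close>

definition great_circle :: "real ^ 3 \<Rightarrow> rp2 set" where
  "great_circle p = abs_rp2 ` {q. norm q = 1 \<and> p \<bullet> q = 0}"

definition menus :: "nat \<Rightarrow> rp2 set set" where
  "menus k = {V. finite V \<and> 1 \<le> card V \<and> card V \<le> k}"

definition menu_overlap :: "rp2 set \<Rightarrow> rp2 \<Rightarrow> real" where
  "menu_overlap V q = Max ((\<lambda>a. overlap q a) ` V)"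

definition outcome_pmf :: "real \<Rightarrow> real \<Rightarrow> int pmf" where
  "outcome_pmf c t = map_pmf (\<lambda>b. if b then 1 else - 1) (bernoulli_pmf ((1 + c * t) / 2))"

text \<open>\<open>bernoulli_pmf\<close> truncates its parameter to the unit interval, so the intended law is
  obtained exactly when \<open>\<bar>c * t\<bar> \<le> 1\<close>.\<close>

lemma pmf_outcome_pmf:
  assumes "\<bar>c * t\<bar> \<le> 1" and "y \<in> {- 1, 1}"
  shows "pmf (outcome_pmf c t) y = (1 + of_int y * c * t) / 2"
proof -
  have inj: "inj (\<lambda>b. if b then 1 else - 1 :: int)"
    by (simp add: inj_def)
  have p: "0 \<le> (1 + c * t) / 2" "(1 + c * t) / 2 \<le> 1"
    using assms(1) by (auto simp: abs_le_iff)
  have "pmf (outcome_pmf c t) 1 = (1 + c * t) / 2"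
    using pmf_map_inj'[OF inj, of "bernoulli_pmf ((1 + c * t) / 2)" True]
      pmf_bernoulli_True[OF p] by (simp add: outcome_pmf_def)
  moreover have "pmf (outcome_pmf c t) (- 1) = 1 - (1 + c * t) / 2"
    using pmf_map_inj'[OF inj, of "bernoulli_pmf ((1 + c * t) / 2)" False]
      pmf_bernoulli_False[OF p] by (simp add: outcome_pmf_def)
  ultimately show ?thesis
    using assms(2) by (auto simp: field_simps)
qed

definition local_target :: "nat \<Rightarrow> real \<Rightarrow> (real \<Rightarrow> real) \<Rightarrow> real \<Rightarrow> real" where
  "local_target n t0 s h = sqrt (real n) * (s (t0 + h / sqrt (real n)) - s t0)"

definition minimax_risk :: "nat \<Rightarrow> real \<Rightarrow> real \<Rightarrow> (real \<Rightarrow> real) \<Rightarrow> real \<Rightarrow> ereal" where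
  "minimax_risk n H t0 s c =
    (if c = 0
     then ((SUP h\<in>{- H..H}. ereal (local_target n t0 s h))
           - (INF h\<in>{- H..H}. ereal (local_target n t0 s h)))\<^sup>2 / 4
     else (INF T :: int list \<Rightarrow> real. SUP h\<in>{- H..H}.
       ereal (measure_pmf.expectation
         (replicate_pmf n (outcome_pmf c (t0 + h / sqrt (real n))))
         (\<lambda>ys. (T ys - local_target n t0 s h)\<^sup>2))))"

definition menu_regret ::
    "rp2 set \<Rightarrow> nat \<Rightarrow> nat \<Rightarrow> real \<Rightarrow> real \<Rightarrow> (real \<Rightarrow> real) \<Rightarrow> ereal" where
  "menu_regret Q n k H t0 s =
    (INF V\<in>menus k. SUP q\<in>Q.
      minimax_risk n H t0 s (menu_overlap V q) - minimax_risk n H t0 s 1)"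

text \<open>In \<^typ>\<open>ereal\<close>, \<open>inverse 0 = \<infinity>\<close>.\<close>

definition menu_frontier :: "rp2 set \<Rightarrow> nat \<Rightarrow> real \<Rightarrow> (real \<Rightarrow> real) \<Rightarrow> ereal" where
  "menu_frontier Q k t0 s =
    (INF V\<in>menus k. SUP q\<in>Q.
      ereal ((deriv s t0)\<^sup>2) * (inverse ((ereal (menu_overlap V q))\<^sup>2) - 1))"

text \<open>At \<open>t = 1\<close> and \<open>t = -1\<close> the convention \<open>0 * ln 0 = 0\<close> holds.\<close>

definition binary_entropy :: "real \<Rightarrow> real" where
  "binary_entropy t =
    - ((1 + t) / 2) * ln ((1 + t) / 2) - ((1 - t) / 2) * ln ((1 - t) / 2)"

end

theory Submission
  imports Defs
begin

text \<open>At overlap \<open>c\<close> the local Fisher information is \<open>1 / (1 / c\<^sup>2 - t0\<^sup>2)\<close>. With \<open>H = n powr (1/6)\<close> the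
  linear estimator has squared linearization bias of order \<open>H ^ 4 / n = n powr (- 1/3)\<close>, and a van Trees
  bound with a prior on \<open>[- H, H]\<close> loses a prior information of order \<open>1 / H\<^sup>2 = n powr (- 1/3)\<close>, so both
  sides give \<open>(artanh t0)\<^sup>2 * (1 / c\<^sup>2 - t0\<^sup>2)\<close> up to that error. In the regret the terms in \<open>t0\<^sup>2\<close>
  cancel and \<open>1 / c\<^sup>2 - 1\<close> remains. On a great circle modulo sign the best guaranteed overlap
  with \<open>k\<close> axes is \<open>c = cos (\<pi>/(2k))\<close>, attained by equally spaced axes, and
  \<open>1 / c\<^sup>2 - 1 = tan\<^sup>2 (\<pi>/(2k))\<close>.\<close>

section \<open>Expectations over binary samples\<close>

text \<open>The lower bound has to hold for every overlap that an arbitrary menu leaves in its worst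
  direction, including overlaps near \<open>0\<close>, where the information vanishes, and
  \<open>0\<close> itself, where \<open>minimax_risk\<close> switches to another formula.
  Monotonicity of the risk in \<open>c\<close> is not established. Instead, the van Trees multiplier
  is fixed by the target overlap \<open>c0\<close>, and an experiment with \<open>c \<le> c0\<close>
  has less information, which can only raise the bound. At overlap \<open>0\<close> the range of the
  target grows in proportion to \<open>H\<close>, which eventually beats the bounded main term. The
  exponent \<open>1/6\<close> balances the two errors, since \<open>H ^ 4 / n = 1 / H ^ 2\<close>
  exactly when \<open>H ^ 6 = n\<close>. At fixed \<open>n\<close> every expectation is a finite
  sum, and the recursion below makes it a polynomial in the outcome mean \<open>\<theta>\<close>.
  Moments and the derivative in the parameter are thus inductions on \<open>n\<close>, with no
  interchange of limits to justify.\<close>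

primrec bexp :: "nat \<Rightarrow> real \<Rightarrow> (int list \<Rightarrow> real) \<Rightarrow> real" where
  "bexp 0 \<theta> f = f []"
| "bexp (Suc n) \<theta> f =
     (1 + \<theta>) / 2 * bexp n \<theta> (\<lambda>ys. f (1 # ys)) + (1 - \<theta>) / 2 * bexp n \<theta> (\<lambda>ys. f (- 1 # ys))"

lemma bexp_add: "bexp n \<theta> (\<lambda>ys. f ys + g ys) = bexp n \<theta> f + bexp n \<theta> g"
  by (induction n arbitrary: f g) (simp_all add: algebra_simps)

lemma bexp_cmult: "bexp n \<theta> (\<lambda>ys. a * f ys) = a * bexp n \<theta> f"
  by (induction n arbitrary: f) (simp_all add: algebra_simps)

lemma bexp_const: "bexp n \<theta> (\<lambda>ys. a) = a"
  by (induction n) (simp_all add: field_simps)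

lemma bexp_nonneg:
  assumes "\<bar>\<theta>\<bar> \<le> 1" "\<And>ys. 0 \<le> f ys"
  shows "0 \<le> bexp n \<theta> f"
  using assms(2)
proof (induction n arbitrary: f)
  case (Suc n)
  then show ?case using assms(1) by (auto intro!: add_nonneg_nonneg mult_nonneg_nonneg)
qed simp

lemma bexp_sum_list: "bexp n \<theta> (\<lambda>ys. real_of_int (sum_list ys)) = n * \<theta>"
proof (induction n)
  case (Suc n)
  have "(\<lambda>ys. real_of_int (sum_list (y # ys))) = (\<lambda>ys. real_of_int (sum_list ys) + y)" for y
    by auto
  then show ?case
    using Suc by (simp only: bexp.simps bexp_add bexp_const) (simp add: field_simps)
qed simp

lemma bexp_variance: "bexp n \<theta> (\<lambda>ys. (real_of_int (sum_list ys) - n * \<theta>)\<^sup>2) = n * (1 - \<theta>\<^sup>2)"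
proof -
  have sq: "bexp n \<theta> (\<lambda>ys. (real_of_int (sum_list ys))\<^sup>2) = n * (1 - \<theta>\<^sup>2) + (n * \<theta>)\<^sup>2"
  proof (induction n)
    case (Suc n)
    have "(\<lambda>ys. (real_of_int (sum_list (y # ys)))\<^sup>2)
      = (\<lambda>ys. (real_of_int (sum_list ys))\<^sup>2 + (2 * y * real_of_int (sum_list ys) + y\<^sup>2))" for y
      by (auto simp: power2_eq_square algebra_simps)
    then show ?case
      using Suc by (simp only: bexp.simps bexp_add bexp_cmult bexp_const bexp_sum_list)
        (simp add: power2_eq_square field_simps)
  qed simp
  have "(\<lambda>ys. (real_of_int (sum_list ys) - n * \<theta>)\<^sup>2)
    = (\<lambda>ys. (real_of_int (sum_list ys))\<^sup>2 + ((- 2 * n * \<theta>) * real_of_int (sum_list ys) + (n * \<theta>)\<^sup>2))"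
    by (auto simp: power2_eq_square algebra_simps)
  then show ?thesis
    by (simp only: bexp_add bexp_cmult bexp_const bexp_sum_list sq) (simp add: power2_eq_square)
qed

text \<open>One outcome \<open>y\<close> has score
  \<open>(y - \<theta>) / (1 - \<theta>\<^sup>2)\<close>, and scores add over the sample. In the
  induction step the score of the new outcome times its weight \<open>(1 + y * \<theta>) / 2\<close>
  equals \<open>y / 2\<close>, the derivative of that weight.\<close>

lemma bexp_has_derivative:
  assumes "\<bar>\<theta>\<bar> < 1"
  shows "((\<lambda>\<theta>. bexp n \<theta> T) has_real_derivative
    bexp n \<theta> (\<lambda>ys. (real_of_int (sum_list ys) - n * \<theta>) * T ys) / (1 - \<theta>\<^sup>2)) (at \<theta>)"
proof (induction n arbitrary: T)
  case (Suc n)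
  let ?S = "\<lambda>ys. real_of_int (sum_list ys) - n * \<theta>"
  have split: "bexp n \<theta> (\<lambda>ys. (real_of_int (sum_list (y # ys)) - Suc n * \<theta>) * T (y # ys))
    = bexp n \<theta> (\<lambda>ys. ?S ys * T (y # ys)) + (y - \<theta>) * bexp n \<theta> (\<lambda>ys. T (y # ys))" for y
  proof -
    have "(\<lambda>ys. (real_of_int (sum_list (y # ys)) - Suc n * \<theta>) * T (y # ys))
      = (\<lambda>ys. ?S ys * T (y # ys) + (y - \<theta>) * T (y # ys))"
      by (auto simp: algebra_simps)
    then show ?thesis by (simp only: bexp_add bexp_cmult)
  qed
  have pos: "0 < 1 - \<theta>\<^sup>2"
    using assms by (simp add: abs_square_less_1)
  have p: "((\<lambda>\<theta>. (1 + \<theta>) / 2) has_real_derivative 1 / 2) (at \<theta>)"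
    and m: "((\<lambda>\<theta>. (1 - \<theta>) / 2) has_real_derivative - 1 / 2) (at \<theta>)"
    by (auto intro!: derivative_eq_intros)
  show ?case
    unfolding bexp.simps(2) split
    by (rule DERIV_cong[OF DERIV_add[OF DERIV_mult[OF p Suc.IH] DERIV_mult[OF m Suc.IH]]])
      (use pos in \<open>simp add: divide_simps\<close>, simp add: algebra_simps power2_eq_square)
qed simp

text \<open>Both sides split off the first outcome. The hypothesis keeps the truncation in
  \<open>bernoulli_pmf\<close> inactive.\<close>

lemma expectation_outcomes:
  assumes "\<bar>c * t\<bar> \<le> 1"
  shows "measure_pmf.expectation (replicate_pmf n (outcome_pmf c t)) f = bexp n (c * t) f"
proof (induction n arbitrary: f)
  case (Suc n)
  have fin: "finite (set_pmf (replicate_pmf n (outcome_pmf c t)))"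
    by (induction n) (auto simp: outcome_pmf_def)
  have "measure_pmf.expectation (replicate_pmf (Suc n) (outcome_pmf c t)) f
    = (\<Sum>y\<in>{1, - 1}. pmf (outcome_pmf c t) y *\<^sub>R
        measure_pmf.expectation (map_pmf ((#) y) (replicate_pmf n (outcome_pmf c t))) f)"
    unfolding replicate_pmf.simps map_pmf_def[symmetric]
    by (rule pmf_expectation_bind) (use fin in \<open>auto simp: outcome_pmf_def\<close>)
  also have "\<dots> = bexp (Suc n) (c * t) f"
    by (simp add: pmf_outcome_pmf[OF assms] Suc)
  finally show ?case .
qed simp

section \<open>The binary entropy\<close>

lemma DERIV_binary_entropy:
  assumes "0 \<le> t" "t < 1"
  shows "(binary_entropy has_real_derivative - artanh t) (at t)"
proof -
  have D: "((\<lambda>x. x * ln x) has_real_derivative ln x + 1) (at x)" if "0 < x" for x :: real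
    using that by (auto intro!: derivative_eq_intros)
  have p: "((\<lambda>t. (1 + t) / 2) has_real_derivative 1 / 2) (at t)"
    and m: "((\<lambda>t. (1 - t) / 2) has_real_derivative - 1 / 2) (at t)"
    by (auto intro!: derivative_eq_intros)
  have "((\<lambda>t. - ((1 + t) / 2 * ln ((1 + t) / 2)) - (1 - t) / 2 * ln ((1 - t) / 2))
    has_real_derivative - ((ln ((1 + t) / 2) + 1) * (1 / 2)) - (ln ((1 - t) / 2) + 1) * (- 1 / 2)) (at t)"
    by (intro DERIV_diff DERIV_minus DERIV_chain2[OF D p] DERIV_chain2[OF D m]) (use assms in auto)
  moreover have "- ((ln ((1 + t) / 2) + 1) * (1 / 2)) - (ln ((1 - t) / 2) + 1) * (- 1 / 2) = - artanh t"
    using assms by (simp add: artanh_def ln_div) (simp add: field_simps)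
  ultimately have "((\<lambda>t. - ((1 + t) / 2) * ln ((1 + t) / 2) - ((1 - t) / 2) * ln ((1 - t) / 2))
    has_real_derivative - artanh t) (at t)"
    by simp
  then show ?thesis
    unfolding binary_entropy_def[abs_def] .
qed

text \<open>Add \<open>- x * ln x \<le> 1 - x\<close> over the two probabilities, whose sum is
  \<open>1\<close>. The constant \<open>1\<close> is cruder than \<open>ln 2\<close>, but it enters
  only crude bounds and finiteness arguments.\<close>

lemma binary_entropy_bounds:
  assumes "t \<in> {0..1}"
  shows "0 \<le> binary_entropy t" "binary_entropy t \<le> 1"
proof -
  have bd: "0 \<le> - x * ln x" "- x * ln x \<le> 1 - x" if "0 \<le> x" "x \<le> 1" for x :: real
  proof -
    show "0 \<le> - x * ln x"
      using that by (cases "x = 0") (auto simp: mult_nonneg_nonpos)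
    show "- x * ln x \<le> 1 - x"
    proof (cases "x = 0")
      case False
      then have "- ln x \<le> 1 / x - 1"
        using that ln_le_minus_one[of "1 / x"] by (simp add: ln_div)
      then have "x * (- ln x) \<le> x * (1 / x - 1)"
        using that by (intro mult_left_mono)
      then show ?thesis using False by (simp add: algebra_simps)
    qed simp
  qed
  show "0 \<le> binary_entropy t"
    using bd(1)[of "(1 + t) / 2"] bd(1)[of "(1 - t) / 2"] assms
    by (simp add: binary_entropy_def)
  show "binary_entropy t \<le> 1"
    using bd(2)[of "(1 + t) / 2"] bd(2)[of "(1 - t) / 2"] assms
    by (simp add: binary_entropy_def field_simps)
qed

lemma artanh_real_mono:
  fixes x y :: real
  assumes "0 \<le> x" "x \<le> y" "y < 1"
  shows "artanh x \<le> artanh y"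
  using assms by (auto simp: artanh_def frac_le)

lemma artanh_real_pos:
  fixes x :: real
  assumes "0 < x" "x < 1"
  shows "0 < artanh x"
  using assms by (simp add: artanh_def)

lemma artanh_real_lipschitz:
  fixes x y b :: real
  assumes "0 \<le> x" "x \<le> b" "0 \<le> y" "y \<le> b" "b < 1"
  shows "\<bar>artanh x - artanh y\<bar> \<le> \<bar>x - y\<bar> / (1 - b\<^sup>2)"
proof -
  have "norm (artanh x - artanh y) \<le> 1 / (1 - b\<^sup>2) * norm (x - y)"
  proof (rule field_differentiable_bound[where S = "{0..b}" and f' = "\<lambda>t. 1 / (1 - t\<^sup>2)"])
    fix t assume t: "t \<in> {0..b}"
    then show "(artanh has_field_derivative 1 / (1 - t\<^sup>2)) (at t within {0..b})"
      using assms by (intro artanh_real_has_field_derivative) auto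
    have "t\<^sup>2 \<le> b\<^sup>2" "b\<^sup>2 < 1"
      using t assms by (auto intro: power_mono simp: abs_square_less_1)
    then show "norm (1 / (1 - t\<^sup>2)) \<le> 1 / (1 - b\<^sup>2)"
      by (simp add: frac_le)
  qed (use assms in auto)
  then show ?thesis by simp
qed

text \<open>The mean value inequality is applied to \<open>binary_entropy x + artanh t * x\<close>,
  whose derivative \<open>artanh t - artanh x\<close> is small on the segment because
  \<open>artanh\<close> is Lipschitz there. Compared with a second-order Taylor bound this loses
  only a factor 2.\<close>

lemma binary_entropy_linearization:
  fixes t u b :: real
  assumes "0 \<le> t" "t \<le> b" "0 \<le> u" "u \<le> b" "b < 1"
  shows "\<bar>binary_entropy u - binary_entropy t + artanh t * (u - t)\<bar> \<le> (u - t)\<^sup>2 / (1 - b\<^sup>2)"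
proof -
  have "norm ((binary_entropy u + artanh t * u) - (binary_entropy t + artanh t * t))
    \<le> \<bar>u - t\<bar> / (1 - b\<^sup>2) * norm (u - t)"
  proof (rule field_differentiable_bound[where S = "closed_segment t u" and f' = "\<lambda>x. artanh t - artanh x"])
    fix x assume x: "x \<in> closed_segment t u"
    then have x': "0 \<le> x" "x \<le> b" "\<bar>x - t\<bar> \<le> \<bar>u - t\<bar>"
      using assms by (auto simp: closed_segment_eq_real_ivl split: if_splits)
    have "(binary_entropy has_real_derivative - artanh x) (at x within closed_segment t u)"
      by (rule has_field_derivative_at_within[OF DERIV_binary_entropy]) (use x' assms in auto)
    then show "((\<lambda>x. binary_entropy x + artanh t * x) has_field_derivative artanh t - artanh x)
      (at x within closed_segment t u)"
      by (auto intro!: derivative_eq_intros)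
    have "\<bar>artanh t - artanh x\<bar> \<le> \<bar>t - x\<bar> / (1 - b\<^sup>2)"
      using artanh_real_lipschitz[of t b x] x' assms by auto
    also have "\<dots> \<le> \<bar>u - t\<bar> / (1 - b\<^sup>2)"
      using x' assms by (intro divide_right_mono) (auto simp: abs_square_le_1)
    finally show "norm (artanh t - artanh x) \<le> \<bar>u - t\<bar> / (1 - b\<^sup>2)" by simp
  qed auto
  then show ?thesis
    by (simp add: algebra_simps power2_eq_square abs_mult[symmetric])
qed

section \<open>A linear estimator and a van Trees bound\<close>

text \<open>An outcome has mean \<open>c * t\<close>, so the centred and scaled sum is an exactly
  unbiased estimate of \<open>h\<close>. The risk is therefore variance plus squared bias without
  remainder, and the variance is \<open>d\<^sup>2\<close> times the inverse Fisher information at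
  \<open>t\<close>.\<close>

lemma linear_estimator_risk:
  fixes t0 h c d a :: real and n :: nat
  assumes "0 < n" "0 < c"
  defines "t \<equiv> t0 + h / sqrt (real n)"
  shows "bexp n (c * t)
      (\<lambda>ys. (d * (real_of_int (sum_list ys) / (c * sqrt n) - sqrt n * t0) - a)\<^sup>2)
    = d\<^sup>2 * (1 / c\<^sup>2 - t\<^sup>2) + (d * h - a)\<^sup>2"
proof -
  let ?S = "\<lambda>ys. real_of_int (sum_list ys) - n * (c * t)"
  have h: "h = sqrt n * t - sqrt n * t0"
    using assms by (simp add: t_def field_simps)
  have sq: "real n = sqrt n * sqrt n"
    by simp
  define X where "X = d / (c * sqrt n)"
  define B where "B = d * h - a"
  have lin: "d * (x / (c * sqrt n) - sqrt n * t0) - a = X * (x - n * (c * t)) + B"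
    for x :: real
    unfolding X_def B_def h by (subst (5) sq) (use assms in \<open>simp add: field_simps\<close>)
  have "(\<lambda>ys. (d * (real_of_int (sum_list ys) / (c * sqrt n) - sqrt n * t0) - a)\<^sup>2)
    = (\<lambda>ys. X\<^sup>2 * (?S ys)\<^sup>2 + (2 * X * B * real_of_int (sum_list ys)
       + (- 2 * X * B * (n * (c * t)) + B\<^sup>2)))"
    unfolding lin by (auto simp: power2_eq_square algebra_simps)
  then have "bexp n (c * t)
      (\<lambda>ys. (d * (real_of_int (sum_list ys) / (c * sqrt n) - sqrt n * t0) - a)\<^sup>2)
    = X\<^sup>2 * n * (1 - (c * t)\<^sup>2) + B\<^sup>2"
    by (simp only: bexp_add bexp_cmult bexp_const bexp_variance bexp_sum_list)
  also have "X\<^sup>2 * n = d\<^sup>2 / c\<^sup>2"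
    using assms by (simp add: X_def power_divide power_mult_distrib)
  also have "d\<^sup>2 / c\<^sup>2 * (1 - (c * t)\<^sup>2) = d\<^sup>2 * (1 / c\<^sup>2 - t\<^sup>2)"
    using \<open>0 < c\<close> by (simp add: power_mult_distrib field_simps)
  finally show ?thesis
    unfolding B_def .
qed

text \<open>A van Trees inequality for the prior density proportional to
  \<open>(1 - (h / H)\<^sup>2)\<^sup>2\<close>, whose Fisher information is \<open>10 / H\<^sup>2\<close>. The Cauchy--Schwarz step is replaced
  by expanding a square with the free multiplier \<open>\<mu>\<close>, and integration over the prior by the
  monotonicity of a primitive.\<close>

lemma van_Trees_bound:
  fixes a a' :: "real \<Rightarrow> real"
  assumes n: "0 < n" and H: "0 < H"
    and small: "\<And>h. h \<in> {- H..H} \<Longrightarrow> \<bar>c * (t0 + h / sqrt (real n))\<bar> < 1"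
    and a': "\<And>h. h \<in> {- H..H} \<Longrightarrow> (a has_real_derivative a' h) (at h)"
    and A: "\<And>h. h \<in> {- H..H} \<Longrightarrow> A \<le> \<mu> * a' h"
    and B: "\<And>h. h \<in> {- H..H} \<Longrightarrow> c\<^sup>2 / (1 - (c * (t0 + h / sqrt (real n)))\<^sup>2) \<le> B"
    and r: "\<And>h. h \<in> {- H..H} \<Longrightarrow>
      bexp n (c * (t0 + h / sqrt (real n))) (\<lambda>ys. (T ys - a h)\<^sup>2) \<le> r"
  shows "2 * A - \<mu>\<^sup>2 * B - 10 * \<mu>\<^sup>2 / H\<^sup>2 \<le> r"
proof -
  define \<theta> where "\<theta> h = c * (t0 + h / sqrt (real n))" for h
  \<comment> \<open>\<open>w\<close> is the square root of the unnormalized prior density. The prior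
    information then has the integrand \<open>4 * (w' h)\<^sup>2\<close>, with no quotient
    degenerating at the ends of the interval.\<close>
  define w where "w h = 1 - (h / H)\<^sup>2" for h
  define w' where "w' h = - 2 * h / H\<^sup>2" for h
  define m where "m h = bexp n (\<theta> h) T" for h
  define S where "S h ys = c / (sqrt n * (1 - (\<theta> h)\<^sup>2)) * (real_of_int (sum_list ys) - n * \<theta> h)"
    for h ys
  define m' where "m' h = bexp n (\<theta> h) (\<lambda>ys. S h ys * T ys)" for h
  \<comment> \<open>Prior density times bias. It vanishes at \<open>H\<close> and \<open>- H\<close>
    because \<open>w\<close> does, so its derivative contributes nothing in total: this is the
    integration by parts of van Trees in primitive form.\<close>
  define G where "G h = (w h)\<^sup>2 * (m h - a h)" for h
  define G' where "G' h = 2 * w h * w' h * (m h - a h) + (w h)\<^sup>2 * (m' h - a' h)" for h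
  define \<kappa> where "\<kappa> = r - 2 * A + \<mu>\<^sup>2 * B"
  define P where "P h = \<kappa> * (h - 2 * h ^ 3 / (3 * H\<^sup>2) + h ^ 5 / (5 * H ^ 4))
    + 4 * \<mu>\<^sup>2 * (4 * h ^ 3 / (3 * H ^ 4)) - 2 * \<mu> * G h" for h

  have pos: "0 < 1 - (\<theta> h)\<^sup>2" if "h \<in> {- H..H}" for h
    using small[OF that] by (simp add: \<theta>_def abs_square_less_1)

  have dG: "(G has_real_derivative G' h) (at h)" if h: "h \<in> {- H..H}" for h
  proof -
    have dw: "(w has_real_derivative w' h) (at h)"
      unfolding w_def[abs_def] w'_def
      using H by (auto intro!: derivative_eq_intros simp: power2_eq_square)
    have dt: "(\<theta> has_real_derivative c / sqrt n) (at h)"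
      unfolding \<theta>_def[abs_def] using n by (auto intro!: derivative_eq_intros simp: field_simps)
    have "(m has_real_derivative bexp n (\<theta> h) (\<lambda>ys. (real_of_int (sum_list ys) - n * \<theta> h) * T ys)
        / (1 - (\<theta> h)\<^sup>2) * (c / sqrt n)) (at h)"
      unfolding m_def[abs_def]
      by (rule DERIV_chain2[OF bexp_has_derivative dt]) (use small[OF h] in \<open>simp add: \<theta>_def\<close>)
    moreover have "m' h = bexp n (\<theta> h) (\<lambda>ys. (real_of_int (sum_list ys) - n * \<theta> h) * T ys)
        / (1 - (\<theta> h)\<^sup>2) * (c / sqrt n)"
      unfolding m'_def S_def mult.assoc bexp_cmult by (simp add: ac_simps)
    ultimately have dm: "(m has_real_derivative m' h) (at h)"
      by simp
    show ?thesis
      unfolding G_def[abs_def] G'_def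
      by (rule derivative_eq_intros dw dm a'[OF h] refl)+ simp
  qed

  have key: "0 \<le> \<kappa> * (w h)\<^sup>2 + 4 * \<mu>\<^sup>2 * (w' h)\<^sup>2 - 2 * \<mu> * G' h" if h: "h \<in> {- H..H}" for h
  proof -
    let ?E = "bexp n (\<theta> h)"
    have ES: "?E (S h) = 0"
    proof -
      have "S h = (\<lambda>ys. c / (sqrt n * (1 - (\<theta> h)\<^sup>2)) * (real_of_int (sum_list ys) + (- n * \<theta> h)))"
        by (auto simp: S_def)
      then show ?thesis
        by (simp only: bexp_add bexp_cmult bexp_const bexp_sum_list) simp
    qed
    have ES2: "?E (\<lambda>ys. (S h ys)\<^sup>2) = c\<^sup>2 / (1 - (\<theta> h)\<^sup>2)"
    proof -
      have "(c / (sqrt n * p))\<^sup>2 * (n * p) = c\<^sup>2 / p" if "0 < p" for p :: real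
        using n that by (simp add: power_mult_distrib power_divide) (simp add: power2_eq_square)
      then show ?thesis
        unfolding S_def power_mult_distrib[of "c / (sqrt n * (1 - (\<theta> h)\<^sup>2))"] bexp_cmult bexp_variance
        using pos[OF h] by blast
    qed
    \<comment> \<open>\<open>w * S + 2 * w'\<close> is \<open>w\<close> times the score of the joint
      density of sample and prior. The square of the weighted error minus \<open>\<mu>\<close> times
      this quantity has nonnegative expectation at each single \<open>h\<close>.\<close>
    have "0 \<le> ?E (\<lambda>ys. (w h * (T ys - a h) - \<mu> * (w h * S h ys + 2 * w' h))\<^sup>2)"
      using small[OF h] by (intro bexp_nonneg) (auto simp: \<theta>_def)
    also have "(\<lambda>ys. (w h * (T ys - a h) - \<mu> * (w h * S h ys + 2 * w' h))\<^sup>2)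
      = (\<lambda>ys. (w h)\<^sup>2 * (T ys - a h)\<^sup>2 + ((- 2 * \<mu> * (w h)\<^sup>2) * (S h ys * T ys)
          + ((- 4 * \<mu> * w h * w' h) * T ys
          + ((2 * \<mu> * (w h)\<^sup>2 * a h + 4 * \<mu>\<^sup>2 * w h * w' h) * S h ys
          + (\<mu>\<^sup>2 * (w h)\<^sup>2 * (S h ys)\<^sup>2 + (4 * \<mu> * w h * w' h * a h + 4 * \<mu>\<^sup>2 * (w' h)\<^sup>2))))))"
      by (auto simp: power2_eq_square algebra_simps)
    also have "?E \<dots> = (w h)\<^sup>2 * ?E (\<lambda>ys. (T ys - a h)\<^sup>2) - 2 * \<mu> * (w h)\<^sup>2 * m' h
        - 4 * \<mu> * w h * w' h * (m h - a h) + \<mu>\<^sup>2 * (w h)\<^sup>2 * (c\<^sup>2 / (1 - (\<theta> h)\<^sup>2)) + 4 * \<mu>\<^sup>2 * (w' h)\<^sup>2"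
      by (simp only: bexp_add bexp_cmult bexp_const ES ES2 m_def[symmetric] m'_def[symmetric])
        (simp add: algebra_simps)
    \<comment> \<open>The cross terms with the joint score combine into \<open>G' h\<close> plus
      \<open>(w h)\<^sup>2 * a' h\<close>: an exact derivative and the slope of the target.\<close>
    also have "\<dots> = (w h)\<^sup>2 * ?E (\<lambda>ys. (T ys - a h)\<^sup>2) - 2 * \<mu> * G' h - 2 * ((w h)\<^sup>2 * (\<mu> * a' h))
        + (\<mu>\<^sup>2 * (w h)\<^sup>2) * (c\<^sup>2 / (1 - (\<theta> h)\<^sup>2)) + 4 * \<mu>\<^sup>2 * (w' h)\<^sup>2"
      by (simp add: G'_def algebra_simps)
    also have "\<dots> \<le> (w h)\<^sup>2 * r - 2 * \<mu> * G' h - 2 * ((w h)\<^sup>2 * A) + (\<mu>\<^sup>2 * (w h)\<^sup>2) * B + 4 * \<mu>\<^sup>2 * (w' h)\<^sup>2"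
    proof -
      have "(w h)\<^sup>2 * ?E (\<lambda>ys. (T ys - a h)\<^sup>2) \<le> (w h)\<^sup>2 * r"
        "(w h)\<^sup>2 * A \<le> (w h)\<^sup>2 * (\<mu> * a' h)"
        "(\<mu>\<^sup>2 * (w h)\<^sup>2) * (c\<^sup>2 / (1 - (\<theta> h)\<^sup>2)) \<le> (\<mu>\<^sup>2 * (w h)\<^sup>2) * B"
        using r[OF h] A[OF h] B[OF h] unfolding \<theta>_def by (intro mult_left_mono; simp)+
      then show ?thesis by linarith
    qed
    finally show ?thesis
      by (simp add: \<kappa>_def algebra_simps)
  qed

  have dP: "(P has_real_derivative \<kappa> * (w h)\<^sup>2 + 4 * \<mu>\<^sup>2 * (w' h)\<^sup>2 - 2 * \<mu> * G' h) (at h)"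
    if h: "h \<in> {- H..H}" for h
  proof -
    have p: "((\<lambda>h. h - 2 * h ^ 3 / (3 * H\<^sup>2) + h ^ 5 / (5 * H ^ 4)) has_real_derivative (w h)\<^sup>2) (at h)"
      using H by (auto intro!: derivative_eq_intros simp: w_def field_simps power2_eq_square eval_nat_numeral)
    have q: "((\<lambda>h. 4 * h ^ 3 / (3 * H ^ 4)) has_real_derivative (w' h)\<^sup>2) (at h)"
      using H by (auto intro!: derivative_eq_intros simp: w'_def field_simps power2_eq_square eval_nat_numeral)
    show ?thesis
      unfolding P_def[abs_def]
      by (intro DERIV_diff DERIV_add DERIV_cmult p q dG[OF h])
  qed
  have "P (- H) \<le> P H"
  proof (rule DERIV_nonneg_imp_nondecreasing[where f = P])
    fix h assume "- H \<le> h" "h \<le> H"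
    then show "\<exists>y. (P has_real_derivative y) (at h) \<and> 0 \<le> y"
      using dP[of h] key[of h] by fastforce
  qed (use H in simp)
  \<comment> \<open>Over the interval, \<open>w\<^sup>2\<close> integrates to
    \<open>16 * H / 15\<close> and \<open>w'\<^sup>2\<close> to \<open>8 / (3 * H)\<close>. The
    constant 10 is 4 times the quotient of these, up to \<open>H\<^sup>2\<close>.\<close>
  moreover have "P H - P (- H) = \<kappa> * (16 * H / 15) + 4 * \<mu>\<^sup>2 * (8 / (3 * H))"
  proof -
    have "G H = 0" "G (- H) = 0"
      using H by (auto simp: G_def w_def)
    then show ?thesis
      using H by (simp add: P_def field_simps eval_nat_numeral)
  qed
  ultimately have "0 \<le> \<kappa> * (16 * H / 15) + 4 * \<mu>\<^sup>2 * (8 / (3 * H))"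
    by linarith
  then have "0 \<le> (\<kappa> * (16 * H / 15) + 4 * \<mu>\<^sup>2 * (8 / (3 * H))) * (15 / (16 * H))"
    using H by (intro mult_nonneg_nonneg) auto
  also have "\<dots> = \<kappa> + 10 * \<mu>\<^sup>2 / H\<^sup>2"
    using H by (simp add: field_simps power2_eq_square)
  finally show ?thesis
    by (simp add: \<kappa>_def)
qed

section \<open>Axes on a great circle\<close>

lemma rp2_obtain_unit:
  obtains v where "norm v = 1" "x = abs_rp2 v"
  using that by (induction x rule: rp2.abs_induct) auto

lemma overlap_abs_rp2:
  assumes "norm q = 1" "norm a = 1"
  shows "overlap (abs_rp2 q) (abs_rp2 a) = \<bar>q \<bullet> a\<bar>"
  using assms by (simp add: overlap.abs_eq)

lemma overlap_bounds: "0 \<le> overlap q a" "overlap q a \<le> 1"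
proof -
  obtain v w where "norm v = 1" "norm w = 1" "q = abs_rp2 v" "a = abs_rp2 w"
    using rp2_obtain_unit by metis
  then show "0 \<le> overlap q a" "overlap q a \<le> 1"
    using Cauchy_Schwarz_ineq2[of v w] by (auto simp: overlap_abs_rp2)
qed

lemma menu_overlap_le_iff:
  assumes "V \<in> menus k"
  shows "menu_overlap V q \<le> b \<longleftrightarrow> (\<forall>a\<in>V. overlap q a \<le> b)"
  using assms by (auto simp: menus_def menu_overlap_def Max_le_iff card_gt_0_iff Suc_le_eq)

lemma menu_overlap_ge_iff:
  assumes "V \<in> menus k"
  shows "b \<le> menu_overlap V q \<longleftrightarrow> (\<exists>a\<in>V. b \<le> overlap q a)"
  using assms by (auto simp: menus_def menu_overlap_def Max_ge_iff card_gt_0_iff Suc_le_eq)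

lemma menu_overlap_bounds:
  assumes "V \<in> menus k"
  shows "0 \<le> menu_overlap V q" "menu_overlap V q \<le> 1"
proof -
  have "V \<noteq> {}"
    using assms by (auto simp: menus_def)
  then show "0 \<le> menu_overlap V q" "menu_overlap V q \<le> 1"
    using overlap_bounds by (auto simp: menu_overlap_le_iff[OF assms] menu_overlap_ge_iff[OF assms])
qed

lemma orthonormal_frame:
  fixes p :: "real ^ 3"
  assumes p: "norm p = 1"
  obtains e f :: "real ^ 3" where "norm e = 1" "norm f = 1" "e \<bullet> f = 0" "p \<bullet> e = 0" "p \<bullet> f = 0"
    "\<And>q. p \<bullet> q = 0 \<Longrightarrow> q = (e \<bullet> q) *\<^sub>R e + (f \<bullet> q) *\<^sub>R f"
proof -
  obtain e0 :: "real ^ 3" where e0: "e0 \<noteq> 0" "p \<bullet> e0 = 0"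
    using orthogonal_to_vector_exists[of p] by (auto simp: orthogonal_def)
  define e where "e = e0 /\<^sub>R norm e0"
  define f where "f = cross3 p e"
  have e: "norm e = 1" "p \<bullet> e = 0"
    using e0 by (auto simp: e_def)
  have orth: "p \<bullet> f = 0" "e \<bullet> f = 0"
    by (simp_all add: f_def dot_cross_self)
  have "(norm f)\<^sup>2 = 1"
    using norm_cross_dot[of p e] p e by (simp add: f_def)
  then have f: "norm f = 1"
    by (simp add: power2_eq_1_iff) (smt (verit) norm_ge_zero)
  show thesis
  proof
    fix q assume q: "p \<bullet> q = 0"
    define v where "v = q - ((e \<bullet> q) *\<^sub>R e + (f \<bullet> q) *\<^sub>R f)"
    have "e \<bullet> e = 1" "f \<bullet> f = 1"
      using e f by (simp_all add: dot_square_norm)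
    then have v: "p \<bullet> v = 0" "e \<bullet> v = 0" "f \<bullet> v = 0"
      using q e orth by (simp_all add: v_def algebra_simps inner_commute[of f e])
    \<comment> \<open>The residual \<open>v\<close> is orthogonal to \<open>p\<close> and
      \<open>e\<close>, so the double cross product formula kills \<open>v\<close> crossed with
      \<open>f\<close>. As \<open>v\<close> is also orthogonal to the unit vector \<open>f\<close>,
      the identity between norm, cross and dot product forces \<open>v = 0\<close>.\<close>
    have "cross3 v f = 0"
      using v by (simp add: f_def Lagrange inner_commute[of v])
    then have "norm v = 0"
      using norm_cross_dot[of v f] f v by (simp add: inner_commute[of v])
    then show "q = (e \<bullet> q) *\<^sub>R e + (f \<bullet> q) *\<^sub>R f"
      by (simp add: v_def)
  qed (use e f orth in auto)
qed

text \<open>The last clause treats axes outside the plane of the circle: only their projection acts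
  on the circle, as a cosine with amplitude at most 1. Tilting an axis out of the plane thus cannot
  improve its coverage.\<close>

lemma great_circle_parametrization:
  fixes p :: "real ^ 3"
  assumes "norm p = 1"
  obtains u :: "real \<Rightarrow> real ^ 3" where
    "\<And>\<theta>. norm (u \<theta>) = 1" "\<And>\<theta>. p \<bullet> u \<theta> = 0" "\<And>\<theta> \<phi>. u \<theta> \<bullet> u \<phi> = cos (\<theta> - \<phi>)"
    "\<And>q. norm q = 1 \<Longrightarrow> p \<bullet> q = 0 \<Longrightarrow> \<exists>\<theta>. q = u \<theta>"
    "\<And>a. norm a = 1 \<Longrightarrow> \<exists>r \<phi>. \<bar>r\<bar> \<le> 1 \<and> (\<forall>\<theta>. u \<theta> \<bullet> a = r * cos (\<theta> - \<phi>))"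
proof -
  obtain e f :: "real ^ 3" where ef: "norm e = 1" "norm f = 1" "e \<bullet> f = 0" "p \<bullet> e = 0" "p \<bullet> f = 0"
    and span: "\<And>q. p \<bullet> q = 0 \<Longrightarrow> q = (e \<bullet> q) *\<^sub>R e + (f \<bullet> q) *\<^sub>R f"
    using orthonormal_frame[OF assms] by metis
  have ip: "e \<bullet> e = 1" "f \<bullet> f = 1" "f \<bullet> e = 0"
    using ef by (simp_all add: dot_square_norm inner_commute)
  define u where "u \<theta> = cos \<theta> *\<^sub>R e + sin \<theta> *\<^sub>R f" for \<theta>
  have uu: "u \<theta> \<bullet> u \<phi> = cos (\<theta> - \<phi>)" for \<theta> \<phi>
    using ip ef by (simp add: u_def inner_add_left inner_add_right cos_diff)
  have polar: "\<exists>r \<phi>. \<bar>r\<bar> \<le> norm a \<and> e \<bullet> a = r * cos \<phi> \<and> f \<bullet> a = r * sin \<phi>" for a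
  proof -
    define z where "z = Complex (e \<bullet> a) (f \<bullet> a)"
    have z: "z = rcis (cmod z) (Arg z)"
      by (simp add: rcis_cmod_Arg)
    \<comment> \<open>Bessel's inequality, read off from the squared norm of the part of
      \<open>a\<close> orthogonal to \<open>e\<close> and \<open>f\<close>.\<close>
    have "0 \<le> (a - (e \<bullet> a) *\<^sub>R e - (f \<bullet> a) *\<^sub>R f) \<bullet> (a - (e \<bullet> a) *\<^sub>R e - (f \<bullet> a) *\<^sub>R f)"
      by simp
    also have "\<dots> = (norm a)\<^sup>2 - ((e \<bullet> a)\<^sup>2 + (f \<bullet> a)\<^sup>2)"
      using ip ef by (simp add: inner_diff_left inner_diff_right dot_square_norm[of a] power2_eq_square
          inner_commute[of a e] inner_commute[of a f] algebra_simps)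
    finally have "(cmod z)\<^sup>2 \<le> (norm a)\<^sup>2"
      by (simp add: z_def cmod_power2)
    then have "cmod z \<le> norm a"
      by (simp add: power2_le_iff_abs_le)
    moreover have "e \<bullet> a = Re (rcis (cmod z) (Arg z))" "f \<bullet> a = Im (rcis (cmod z) (Arg z))"
      unfolding z[symmetric] by (simp_all add: z_def)
    ultimately show ?thesis
      by (intro exI[of _ "cmod z"] exI[of _ "Arg z"]) simp
  qed
  show thesis
  proof
    fix \<theta> show "norm (u \<theta>) = 1"
      using uu[of \<theta> \<theta>] by (simp add: norm_eq_1)
    show "p \<bullet> u \<theta> = 0"
      using ef by (simp add: u_def inner_add_right)
  next
    fix \<theta> \<phi> show "u \<theta> \<bullet> u \<phi> = cos (\<theta> - \<phi>)"
      by (rule uu)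
  next
    fix q assume q: "norm q = 1" "p \<bullet> q = 0"
    obtain r \<phi> where r: "e \<bullet> q = r * cos \<phi>" "f \<bullet> q = r * sin \<phi>"
      using polar by blast
    have "q = r *\<^sub>R u \<phi>"
      using span[OF q(2)] r by (simp add: u_def algebra_simps)
    moreover have "norm (u \<phi>) = 1"
      using uu[of \<phi> \<phi>] by (simp add: norm_eq_1)
    ultimately have "r = 1 \<or> r = - 1"
      using q by auto
    \<comment> \<open>A half turn absorbs the sign, so the case \<open>r = - 1\<close> is again a
      point of the parametrization.\<close>
    moreover have "- u \<phi> = u (\<phi> + pi)"
      by (simp add: u_def)
    ultimately show "\<exists>\<theta>. q = u \<theta>"
      using \<open>q = r *\<^sub>R u \<phi>\<close> by auto
  next
    fix a :: "real ^ 3" assume a: "norm a = 1"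
    obtain r \<phi> where r: "\<bar>r\<bar> \<le> 1" "e \<bullet> a = r * cos \<phi>" "f \<bullet> a = r * sin \<phi>"
      using polar[of a] a by auto
    have "u \<theta> \<bullet> a = r * cos (\<theta> - \<phi>)" for \<theta>
      using r by (simp add: u_def inner_add_left cos_diff algebra_simps)
    then show "\<exists>r \<phi>. \<bar>r\<bar> \<le> 1 \<and> (\<forall>\<theta>. u \<theta> \<bullet> a = r * cos (\<theta> - \<phi>))"
      using r by blast
  qed
qed

text \<open>For \<open>0 < \<bar>m\<bar> < k\<close> the angle \<open>\<bar>m\<bar> * pi / k\<close>
  stays at least \<open>pi / k\<close> away from both \<open>0\<close> and \<open>pi\<close>, the
  points where the absolute cosine is 1.\<close>

lemma abs_cos_int_pi_over_le:
  fixes m :: int and k :: nat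
  assumes "m \<noteq> 0" "\<bar>m\<bar> < k"
  shows "\<bar>cos (m * pi / k)\<bar> \<le> cos (pi / k)"
proof -
  have k: "0 < k" using assms by auto
  define x where "x = real_of_int \<bar>m\<bar> * pi / k"
  have cx: "cos (m * pi / k) = cos x"
    by (cases "0 \<le> m") (auto simp: x_def)
  have "1 \<le> real_of_int \<bar>m\<bar>" "real_of_int \<bar>m\<bar> \<le> k - 1"
    using assms by linarith+
  then have "1 * pi / k \<le> x" "x \<le> (k - 1) * pi / k"
    unfolding x_def by (intro divide_right_mono mult_right_mono; simp)+
  then have "pi / k \<le> x" "x \<le> pi - pi / k"
    using k by (auto simp: field_simps)
  moreover have "0 \<le> pi / k" by simp
  ultimately have "cos x \<le> cos (pi / k)" "cos (pi - pi / k) \<le> cos x"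
    by (intro cos_monotone_0_pi_le; linarith)+
  then show ?thesis
    unfolding cx by (simp add: abs_le_iff)
qed

text \<open>The triangle inequality on the projective circle: two directions within
  \<open>\<beta>\<close> of one axis are within \<open>2 * \<beta>\<close> of each other. Working
  with the addition formula avoids reducing angles modulo \<open>pi\<close>.\<close>

lemma abs_cos_diff_gt:
  fixes \<beta> x y :: real
  assumes \<beta>: "0 \<le> cos \<beta>" and x: "cos \<beta> < \<bar>cos x\<bar>" and y: "cos \<beta> < \<bar>cos y\<bar>"
  shows "cos (2 * \<beta>) < \<bar>cos (x - y)\<bar>"
proof -
  have s: "\<bar>sin z\<bar> \<le> \<bar>sin \<beta>\<bar>" if "cos \<beta> < \<bar>cos z\<bar>" for z
  proof -
    have "(cos \<beta>)\<^sup>2 \<le> (cos z)\<^sup>2"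
      using power_mono[of "cos \<beta>" "\<bar>cos z\<bar>" 2] that \<beta> by simp
    then have "(sin z)\<^sup>2 \<le> (sin \<beta>)\<^sup>2"
      by (simp add: sin_squared_eq)
    then show ?thesis by (simp add: abs_le_square_iff)
  qed
  have "cos \<beta> * cos \<beta> < \<bar>cos x\<bar> * \<bar>cos y\<bar>"
    using assms by (intro mult_strict_mono') auto
  moreover have "\<bar>sin x\<bar> * \<bar>sin y\<bar> \<le> \<bar>sin \<beta>\<bar> * \<bar>sin \<beta>\<bar>"
    using s[OF x] s[OF y] by (intro mult_mono) auto
  moreover have "\<bar>cos x * cos y\<bar> - \<bar>sin x * sin y\<bar> \<le> \<bar>cos (x - y)\<bar>"
    unfolding cos_diff by linarith
  ultimately show ?thesis
    by (simp add: cos_double abs_mult power2_eq_square)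
qed

text \<open>The \<open>k\<close> test angles are spaced by \<open>\<pi>/k\<close>, so each axis can be \<open>\<pi>/(2k)\<close>-close to at most
  one of them; the first axis is close to none, as the test angles start at distance exactly
  \<open>\<pi>/(2k)\<close> from it.\<close>

lemma exists_poorly_covered_direction:
  fixes p :: "real ^ 3"
  assumes p: "norm p = 1" and k: "2 \<le> k" and V: "V \<in> menus k"
  shows "\<exists>q\<in>great_circle p. menu_overlap V q \<le> cos (pi / (2 * real k))"
proof -
  let ?\<beta> = "pi / (2 * real k)"
  obtain u :: "real \<Rightarrow> real ^ 3" where u: "\<And>\<theta>. norm (u \<theta>) = 1" "\<And>\<theta>. p \<bullet> u \<theta> = 0"
    and ua: "\<And>a. norm a = 1 \<Longrightarrow> \<exists>r \<phi>. \<bar>r\<bar> \<le> 1 \<and> (\<forall>\<theta>. u \<theta> \<bullet> a = r * cos (\<theta> - \<phi>))"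
    using great_circle_parametrization[OF p] by metis
  have "\<exists>\<phi>. \<forall>\<theta>. overlap (abs_rp2 (u \<theta>)) a \<le> \<bar>cos (\<theta> - \<phi>)\<bar>" for a
  proof -
    obtain v where v: "norm v = 1" "a = abs_rp2 v"
      by (rule rp2_obtain_unit)
    obtain r \<phi> where "\<bar>r\<bar> \<le> 1" "\<And>\<theta>. u \<theta> \<bullet> v = r * cos (\<theta> - \<phi>)"
      using ua[OF v(1)] by blast
    then have "overlap (abs_rp2 (u \<theta>)) a \<le> \<bar>cos (\<theta> - \<phi>)\<bar>" for \<theta>
      using u v by (simp add: overlap_abs_rp2 abs_mult mult_left_le_one_le)
    then show ?thesis by blast
  qed
  then obtain \<phi> where \<phi>: "\<And>a \<theta>. overlap (abs_rp2 (u \<theta>)) a \<le> \<bar>cos (\<theta> - \<phi> a)\<bar>"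
    by metis
  obtain a0 where a0: "a0 \<in> V"
    using V by (fastforce simp: menus_def)
  define \<theta> where "\<theta> j = \<phi> a0 + ?\<beta> + real j * pi / real k" for j :: nat
  have cb: "0 \<le> cos ?\<beta>"
    using k by (intro cos_ge_zero) (auto simp: field_simps intro: order.trans[of _ 0])
  have first: "\<bar>cos (\<theta> j - \<phi> a0)\<bar> \<le> cos ?\<beta>" if "j < k" for j
  proof -
    \<comment> \<open>The offset by half a spacing makes these odd multiples of
      \<open>pi / (2 * k)\<close>, so none of them is a multiple of \<open>pi\<close>.\<close>
    have "\<theta> j - \<phi> a0 = real_of_int (int (2 * j + 1)) * pi / real (2 * k)"
      using k by (simp add: \<theta>_def field_simps)
    then show ?thesis
      using abs_cos_int_pi_over_le[of "int (2 * j + 1)" "2 * k"] that k by simp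
  qed
  have "\<exists>j<k. \<forall>a\<in>V. \<bar>cos (\<theta> j - \<phi> a)\<bar> \<le> cos ?\<beta>"
  proof (rule ccontr)
    assume "\<not> ?thesis"
    then have "\<forall>j<k. \<exists>a\<in>V. cos ?\<beta> < \<bar>cos (\<theta> j - \<phi> a)\<bar>"
      by (meson not_le)
    then obtain b where b: "\<And>j. j < k \<Longrightarrow> b j \<in> V \<and> cos ?\<beta> < \<bar>cos (\<theta> j - \<phi> (b j))\<bar>"
      by metis
    have "inj_on b {..<k}"
    proof (rule inj_onI, rule ccontr)
      fix i j assume ij: "i \<in> {..<k}" "j \<in> {..<k}" "b i = b j" "i \<noteq> j"
      have "cos (2 * ?\<beta>) < \<bar>cos ((\<theta> i - \<phi> (b i)) - (\<theta> j - \<phi> (b j)))\<bar>"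
        using b[of i] b[of j] ij by (intro abs_cos_diff_gt cb) auto
      also have "(\<theta> i - \<phi> (b i)) - (\<theta> j - \<phi> (b j)) = real_of_int (int i - int j) * pi / k"
        using ij k by (simp add: \<theta>_def field_simps)
      also have "\<bar>cos \<dots>\<bar> \<le> cos (pi / k)"
        using ij by (intro abs_cos_int_pi_over_le) auto
      finally show False
        using k by simp
    qed
    \<comment> \<open>The pigeonhole count: \<open>k\<close> well covered test angles would need
      \<open>k\<close> distinct axes besides \<open>a0\<close>, but the menu has at most
      \<open>k\<close> axes in all.\<close>
    moreover have "b ` {..<k} \<subseteq> V - {a0}"
      using b first by (fastforce simp: not_le[symmetric])
    moreover have "finite V"
      using V by (simp add: menus_def)
    ultimately have "k \<le> card (V - {a0})"
      by (metis card_image card_lessThan card_mono finite_Diff)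
    also have "\<dots> < card V"
      using \<open>finite V\<close> a0 by (intro psubset_card_mono) auto
    finally show False
      using V by (simp add: menus_def)
  qed
  then obtain j where "\<forall>a\<in>V. \<bar>cos (\<theta> j - \<phi> a)\<bar> \<le> cos ?\<beta>"
    by blast
  then have "\<forall>a\<in>V. overlap (abs_rp2 (u (\<theta> j))) a \<le> cos ?\<beta>"
    using \<phi> order.trans by blast
  then show ?thesis
    using u by (intro bexI[of _ "abs_rp2 (u (\<theta> j))"])
      (auto simp: menu_overlap_le_iff[OF V] great_circle_def)
qed

lemma exists_equispaced_menu:
  fixes p :: "real ^ 3"
  assumes p: "norm p = 1" and k: "1 \<le> k"
  shows "\<exists>V\<in>menus k. \<forall>q\<in>great_circle p. cos (pi / (2 * real k)) \<le> menu_overlap V q"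
proof -
  let ?\<beta> = "pi / (2 * real k)"
  obtain u :: "real \<Rightarrow> real ^ 3" where u: "\<And>\<theta>. norm (u \<theta>) = 1"
    "\<And>\<theta> \<phi>. u \<theta> \<bullet> u \<phi> = cos (\<theta> - \<phi>)" "\<And>q. norm q = 1 \<Longrightarrow> p \<bullet> q = 0 \<Longrightarrow> \<exists>\<theta>. q = u \<theta>"
    using great_circle_parametrization[OF p] by metis
  define V where "V = (\<lambda>j. abs_rp2 (u (real j * pi / k))) ` {..<k}"
  have V: "V \<in> menus k"
    using k card_image_le[of "{..<k}" "\<lambda>j. abs_rp2 (u (real j * pi / k))"]
    by (auto simp: V_def menus_def Suc_le_eq card_gt_0_iff)
  moreover have "cos ?\<beta> \<le> menu_overlap V q" if q: "q \<in> great_circle p" for q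
  proof -
    obtain \<theta> where \<theta>: "q = abs_rp2 (u \<theta>)"
      using q u(3) by (auto simp: great_circle_def)
    \<comment> \<open>Rounding picks the nearest multiple of \<open>pi / k\<close>, at distance at
      most half a spacing. Only its residue \<open>j\<close> modulo \<open>k\<close> names an axis
      of the menu.\<close>
    define m where "m = round (\<theta> * k / pi)"
    define j where "j = nat (m mod int k)"
    have j: "j < k" "int j = m mod int k"
      using k by (auto simp: j_def nat_less_iff)
    have m: "m = int k * (m div int k) + int j"
      unfolding j by simp
    have "\<bar>m - \<theta> * k / pi\<bar> \<le> 1 / 2"
      unfolding m_def by (rule of_int_round_abs_le)
    then have "\<bar>m - \<theta> * k / pi\<bar> * (pi / k) \<le> 1 / 2 * (pi / k)"
      by (rule mult_right_mono) simp
    also have "\<bar>m - \<theta> * k / pi\<bar> * (pi / k) = \<bar>(m - \<theta> * k / pi) * (pi / k)\<bar>"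
      by (simp add: abs_mult)
    also have "(m - \<theta> * k / pi) * (pi / k) = m * pi / k - \<theta>"
      using k by (simp add: field_simps)
    finally have close: "\<bar>\<theta> - m * pi / k\<bar> \<le> ?\<beta>"
      by (simp add: abs_minus_commute)
    have "?\<beta> \<le> pi / 1"
      using k by (intro divide_left_mono) auto
    then have "cos ?\<beta> \<le> cos \<bar>\<theta> - m * pi / k\<bar>"
      using close by (intro cos_monotone_0_pi_le) auto
    then have "cos ?\<beta> \<le> \<bar>cos (\<theta> - m * pi / k)\<bar>"
      by simp
    have s0: "sin (real_of_int (m div int k) * pi) = 0"
      by (simp add: sin_times_pi_eq_0)
    note \<open>cos ?\<beta> \<le> \<bar>cos (\<theta> - m * pi / k)\<bar>\<close>
    \<comment> \<open>Passing from \<open>m\<close> to \<open>j\<close> shifts the angle by a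
      multiple of \<open>pi\<close>, which changes at most the sign of the cosine.\<close>
    also have "\<theta> - m * pi / k = (\<theta> - real j * pi / k) - (m div int k) * pi"
      using k by (subst m) (simp add: field_simps)
    also have "\<bar>cos \<dots>\<bar> = \<bar>cos (\<theta> - real j * pi / k)\<bar>"
      using s0 sin_zero_abs_cos_one[OF s0]
      by (simp add: cos_diff[of "\<theta> - real j * pi / k"] abs_mult)
    also have "\<dots> = overlap q (abs_rp2 (u (real j * pi / k)))"
      unfolding \<theta> by (simp add: overlap_abs_rp2 u)
    finally show ?thesis
      unfolding menu_overlap_ge_iff[OF V] using j by (auto simp: V_def)
  qed
  ultimately show ?thesis by blast
qed

section \<open>Minimax risks\<close>

lemma minimax_risk_leI:
  assumes "0 < c" and small: "\<And>h. h \<in> {- H..H} \<Longrightarrow> \<bar>c * (t0 + h / sqrt (real n))\<bar> \<le> 1"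
    and U: "\<And>h. h \<in> {- H..H} \<Longrightarrow>
      bexp n (c * (t0 + h / sqrt (real n))) (\<lambda>ys. (T ys - local_target n t0 s h)\<^sup>2) \<le> U"
  shows "minimax_risk n H t0 s c \<le> ereal U"
proof -
  have "minimax_risk n H t0 s c \<le> (SUP h\<in>{- H..H}. ereal (measure_pmf.expectation
         (replicate_pmf n (outcome_pmf c (t0 + h / sqrt (real n))))
         (\<lambda>ys. (T ys - local_target n t0 s h)\<^sup>2)))"
    using assms(1) by (auto simp: minimax_risk_def intro: INF_lower)
  also have "\<dots> \<le> ereal U"
    using U by (intro SUP_least) (simp add: expectation_outcomes[OF small])
  finally show ?thesis .
qed

text \<open>The worst-case risk of an estimator may be infinite. Quantifying over real upper bounds
  \<open>r\<close> keeps the premise in real arithmetic; if the claim failed, density would give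
  such an \<open>r\<close> below \<open>L\<close>.\<close>

lemma minimax_risk_geI:
  assumes "0 < c" and small: "\<And>h. h \<in> {- H..H} \<Longrightarrow> \<bar>c * (t0 + h / sqrt (real n))\<bar> \<le> 1"
    and L: "\<And>T r. (\<And>h. h \<in> {- H..H} \<Longrightarrow>
      bexp n (c * (t0 + h / sqrt (real n))) (\<lambda>ys. (T ys - local_target n t0 s h)\<^sup>2) \<le> r) \<Longrightarrow> L \<le> r"
  shows "ereal L \<le> minimax_risk n H t0 s c"
proof -
  have "ereal L \<le> (SUP h\<in>{- H..H}. ereal (measure_pmf.expectation
         (replicate_pmf n (outcome_pmf c (t0 + h / sqrt (real n))))
         (\<lambda>ys. (T ys - local_target n t0 s h)\<^sup>2)))" (is "_ \<le> ?S") for T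
  proof (rule ccontr)
    assume "\<not> ereal L \<le> ?S"
    then have "?S < ereal L"
      by (simp only: not_le)
    from ereal_dense2[OF this] obtain r where r: "?S < ereal r" "ereal r < ereal L"
      by (elim exE conjE)
    have "L \<le> r"
    proof (rule L)
      fix h assume h: "h \<in> {- H..H}"
      have "ereal (bexp n (c * (t0 + h / sqrt (real n))) (\<lambda>ys. (T ys - local_target n t0 s h)\<^sup>2)) \<le> ?S"
        using h by (intro SUP_upper2[OF h]) (simp add: expectation_outcomes[OF small])
      from le_less_trans[OF this r(1)]
      show "bexp n (c * (t0 + h / sqrt (real n))) (\<lambda>ys. (T ys - local_target n t0 s h)\<^sup>2) \<le> r"
        by simp
    qed
    then show False using r by simp
  qed
  then show ?thesis
    using assms(1) by (auto simp: minimax_risk_def intro: INF_greatest)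
qed

text \<open>Boundedness of the target makes the supremum and infimum real, so that the extended
  subtraction in the formula for \<open>c = 0\<close> is an ordinary one.\<close>

lemma minimax_risk_zero:
  assumes "0 \<le> H" and K: "\<And>h. h \<in> {- H..H} \<Longrightarrow> \<bar>local_target n t0 s h\<bar> \<le> K"
  obtains l u where "minimax_risk n H t0 s 0 = ereal ((u - l)\<^sup>2 / 4)" "- K \<le> l" "l \<le> u" "u \<le> K"
    "\<And>h. h \<in> {- H..H} \<Longrightarrow> l \<le> local_target n t0 s h \<and> local_target n t0 s h \<le> u"
proof -
  let ?a = "local_target n t0 s"
  let ?S = "SUP h\<in>{- H..H}. ereal (?a h)" and ?I = "INF h\<in>{- H..H}. ereal (?a h)"
  have 0: "0 \<in> {- H..H}" using assms by simp
  have bd: "- K \<le> ?a h" "?a h \<le> K" if "h \<in> {- H..H}" for h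
    using K[OF that] by auto
  have S: "ereal (?a 0) \<le> ?S" "?S \<le> ereal K" and I: "?I \<le> ereal (?a 0)" "ereal (- K) \<le> ?I"
    using bd 0 by (auto intro!: SUP_upper SUP_least INF_lower INF_greatest)
  obtain u where u: "?S = ereal u" using S by (cases ?S) auto
  obtain l where l: "?I = ereal l" using I by (cases ?I) auto
  have in_range: "l \<le> ?a h \<and> ?a h \<le> u" if "h \<in> {- H..H}" for h
    using SUP_upper[OF that, of "\<lambda>h. ereal (?a h)"] INF_lower[OF that, of "\<lambda>h. ereal (?a h)"]
    unfolding u l by simp
  show thesis
  proof
    show "minimax_risk n H t0 s 0 = ereal ((u - l)\<^sup>2 / 4)"
      unfolding minimax_risk_def u l by (simp add: power2_eq_square)
    show "l \<le> u" using in_range[OF 0] by simp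
    show "- K \<le> l" using I(2) unfolding l by simp
    show "u \<le> K" using S(2) unfolding u by simp
  qed (rule in_range)
qed

text \<open>The local target is at most \<open>sqrt n\<close> in absolute value, so the constant
  estimator \<open>0\<close> has risk at most \<open>n\<close>; for \<open>c = 0\<close> a quarter
  of the squared range obeys the same bound. This serves sample sizes below the asymptotic
  regime.\<close>

lemma minimax_risk_crude_bounds:
  assumes n: "0 < n" and H: "0 \<le> H" and c: "0 \<le> c" "c \<le> 1"
    and range: "\<And>h. h \<in> {- H..H} \<Longrightarrow> t0 + h / sqrt (real n) \<in> {0..1}"
    and s: "\<And>t. t \<in> {0..1} \<Longrightarrow> 0 \<le> s t \<and> s t \<le> 1"
  shows "0 \<le> minimax_risk n H t0 s c" "minimax_risk n H t0 s c \<le> ereal n"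
proof -
  have t0: "t0 \<in> {0..1}" using range[of 0] H by simp
  have a: "\<bar>local_target n t0 s h\<bar> \<le> sqrt n" if "h \<in> {- H..H}" for h
  proof -
    have "\<bar>s (t0 + h / sqrt n) - s t0\<bar> \<le> 1"
      using s[OF range[OF that]] s[OF t0] by linarith
    then have "sqrt n * \<bar>s (t0 + h / sqrt n) - s t0\<bar> \<le> sqrt n * 1"
      by (intro mult_left_mono) auto
    then show ?thesis by (simp add: local_target_def abs_mult)
  qed
  have "0 \<le> minimax_risk n H t0 s c \<and> minimax_risk n H t0 s c \<le> ereal n"
  proof (cases "c = 0")
    case True
    obtain l u where lu: "minimax_risk n H t0 s 0 = ereal ((u - l)\<^sup>2 / 4)" "- sqrt n \<le> l" "l \<le> u" "u \<le> sqrt n"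
      using minimax_risk_zero[OF H a] by blast
    then have "(u - l)\<^sup>2 \<le> (2 * sqrt n)\<^sup>2"
      by (intro power_mono) auto
    then show ?thesis using True lu by simp
  next
    case False
    then have c0: "0 < c" using c by simp
    have small: "\<bar>c * (t0 + h / sqrt n)\<bar> \<le> 1" if "h \<in> {- H..H}" for h
      unfolding abs_mult using range[OF that] c by (intro mult_le_one) auto
    have "minimax_risk n H t0 s c \<le> ereal n"
    proof (rule minimax_risk_leI[OF c0 small])
      fix h assume h: "h \<in> {- H..H}"
      have "(local_target n t0 s h)\<^sup>2 \<le> (sqrt n)\<^sup>2"
        using a[OF h] power_mono[of "\<bar>local_target n t0 s h\<bar>" "sqrt n" 2] by simp
      then show "bexp n (c * (t0 + h / sqrt n)) (\<lambda>ys. (0 - local_target n t0 s h)\<^sup>2) \<le> n"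
        by (simp add: bexp_const)
    qed auto
    moreover have "ereal 0 \<le> minimax_risk n H t0 s c"
    proof (rule minimax_risk_geI[OF c0 small])
      fix T r
      assume "\<And>h. h \<in> {- H..H} \<Longrightarrow>
        bexp n (c * (t0 + h / sqrt n)) (\<lambda>ys. (T ys - local_target n t0 s h)\<^sup>2) \<le> r"
      from this[of 0] show "0 \<le> r"
        using H small[of 0] bexp_nonneg[of "c * t0" "\<lambda>ys. (T ys - local_target n t0 s 0)\<^sup>2" n]
        by simp
    qed auto
    ultimately show ?thesis by (simp add: zero_ereal_def)
  qed
  then show "0 \<le> minimax_risk n H t0 s c" "minimax_risk n H t0 s c \<le> ereal n"
    by auto
qed

section \<open>Two-sided risk bounds for the entropy target at scale \<open>H\<close>\<close>

locale entropy_experiment =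
  fixes \<tau> t0 H :: real and n :: nat
  assumes \<tau>: "0 < \<tau>" "\<tau> < 1 / 2" and t0: "t0 \<in> {\<tau>..1 - \<tau>}"
    and n: "0 < n" and H_def: "H = real n powr (1 / 6)"
    and H_large: "1 / H\<^sup>2 \<le> \<tau> / 2"
begin

text \<open>The entropy has slope \<open>- d\<close> at \<open>t0\<close>. \<open>D\<close> bounds
  \<open>d\<close> uniformly in \<open>t0\<close>, and \<open>M\<close> is the Lipschitz constant of
  \<open>artanh\<close> up to \<open>1 - \<tau> / 2\<close>.\<close>

abbreviation "d \<equiv> artanh t0"
abbreviation "D \<equiv> artanh (1 - \<tau>)"
abbreviation "M \<equiv> 1 / (1 - (1 - \<tau> / 2)\<^sup>2)"
definition t :: "real \<Rightarrow> real" where "t h = t0 + h / sqrt (real n)"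

lemma H_pos: "0 < H"
  using n by (simp add: H_def)

lemma sqrt_n: "sqrt (real n) = H ^ 3"
proof -
  have "H ^ 3 = real n powr (real 3 * (1 / 6))"
    unfolding H_def by (rule powr_power) (use n in simp)
  also have "real 3 * (1 / 6) = 1 / 2"
    by simp
  finally show ?thesis
    by (simp only: powr_half_sqrt of_nat_0_le_iff)
qed

lemma d_bounds: "0 < d" "d \<le> D"
  using \<tau> t0 by (auto intro!: artanh_real_pos artanh_real_mono)

lemma curvature_bounds: "\<tau> / 2 \<le> 1 - (1 - \<tau> / 2)\<^sup>2" "0 < M"
proof -
  have "1 - (1 - \<tau> / 2)\<^sup>2 = \<tau> - \<tau> * \<tau> / 4"
    by (simp add: power2_eq_square field_simps)
  moreover have "\<tau> * \<tau> \<le> \<tau> * 1"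
    using \<tau> by (intro mult_left_mono) auto
  ultimately show "\<tau> / 2 \<le> 1 - (1 - \<tau> / 2)\<^sup>2"
    using \<tau> by linarith
  then show "0 < M"
    using \<tau> by simp
qed

lemma local_step:
  assumes "h \<in> {- H..H}"
  shows "\<bar>h / sqrt n\<bar> \<le> 1 / H\<^sup>2"
  using assms H_pos by (auto simp: sqrt_n abs_le_iff divide_simps power2_eq_square power3_eq_cube)

text \<open>Since \<open>sqrt n = H ^ 3\<close>, the largest shift is \<open>1 / H\<^sup>2\<close>.
  \<open>H_large\<close> lets it use up only half of the distance \<open>\<tau>\<close> to the
  endpoints, so all later constants depend on \<open>\<tau>\<close> alone.\<close>

lemma t_range:
  assumes "h \<in> {- H..H}"
  shows "\<tau> / 2 \<le> t h" "t h \<le> 1 - \<tau> / 2"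
  using local_step[OF assms] H_large t0 unfolding t_def abs_le_iff atLeastAtMost_iff by linarith+

lemma t_sq_close:
  assumes "h \<in> {- H..H}"
  shows "\<bar>(t h)\<^sup>2 - t0\<^sup>2\<bar> \<le> 2 / H\<^sup>2"
proof -
  have "\<bar>(t h)\<^sup>2 - t0\<^sup>2\<bar> = \<bar>h / sqrt n\<bar> * \<bar>t h + t0\<bar>"
    unfolding t_def abs_mult[symmetric] by (simp only: power2_eq_square algebra_simps)
  also have "\<dots> \<le> (1 / H\<^sup>2) * 2"
    using local_step[OF assms] t_range[OF assms] t0 \<tau> by (intro mult_mono) auto
  finally show ?thesis by simp
qed

lemma ct_small:
  assumes "h \<in> {- H..H}" "0 < c" "c \<le> 1"
  shows "\<bar>c * t h\<bar> < 1"
proof -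
  have "\<bar>c * t h\<bar> = c * t h"
    using t_range[OF assms(1)] assms \<tau> by (simp add: abs_mult)
  also have "\<dots> \<le> 1 * (1 - \<tau> / 2)"
    using t_range[OF assms(1)] assms \<tau> by (intro mult_mono) auto
  finally show ?thesis using \<tau> by simp
qed

text \<open>The linear estimator with slope \<open>- d\<close> is used. The term
  \<open>2 * D\<^sup>2\<close> pays for replacing \<open>t h\<close> by \<open>t0\<close> in the
  variance, and \<open>M\<^sup>2\<close> for the linearization bias, which is at most
  \<open>M * H\<^sup>2 / H ^ 3\<close>.\<close>

lemma minimax_risk_upper:
  assumes c: "0 < c" "c \<le> 1"
  shows "minimax_risk n H t0 binary_entropy c \<le> ereal (d\<^sup>2 * (1 / c\<^sup>2 - t0\<^sup>2) + (2 * D\<^sup>2 + M\<^sup>2) / H\<^sup>2)"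
proof (rule minimax_risk_leI, fold t_def)
  fix h assume h: "h \<in> {- H..H}"
  show "\<bar>c * t h\<bar> \<le> 1"
    using ct_small[OF h c] by simp
  let ?a = "local_target n t0 binary_entropy h"
  have "\<bar>binary_entropy (t h) - binary_entropy t0 + d * (t h - t0)\<bar> \<le> (t h - t0)\<^sup>2 / (1 - (1 - \<tau> / 2)\<^sup>2)"
    using t_range[OF h] t0 \<tau> by (intro binary_entropy_linearization) auto
  then have "H ^ 3 * \<bar>binary_entropy (t h) - binary_entropy t0 + d * (t h - t0)\<bar>
      \<le> H ^ 3 * ((t h - t0)\<^sup>2 / (1 - (1 - \<tau> / 2)\<^sup>2))"
    using H_pos by (intro mult_left_mono) auto
  also have "H ^ 3 * ((t h - t0)\<^sup>2 / (1 - (1 - \<tau> / 2)\<^sup>2)) = M * (h\<^sup>2 / H ^ 3)"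
  proof -
    have "X * ((h / X)\<^sup>2 / (1 - (1 - \<tau> / 2)\<^sup>2)) = M * (h\<^sup>2 / X)" if "0 < X" for X
      using that by (simp add: power_divide power2_eq_square)
    from this[of "H ^ 3"] show ?thesis
      using H_pos by (simp add: t_def sqrt_n)
  qed
  also have "M * (h\<^sup>2 / H ^ 3) \<le> M * (H\<^sup>2 / H ^ 3)"
    using h H_pos curvature_bounds(2)
    by (intro mult_left_mono divide_right_mono) (auto simp: abs_le_square_iff[symmetric])
  also have "H ^ 3 * \<bar>binary_entropy (t h) - binary_entropy t0 + d * (t h - t0)\<bar> = \<bar>- d * h - ?a\<bar>"
  proof -
    have "H ^ 3 * \<bar>binary_entropy (t h) - binary_entropy t0 + d * (t h - t0)\<bar>
      = \<bar>H ^ 3 * (binary_entropy (t h) - binary_entropy t0 + d * (t h - t0))\<bar>"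
      using H_pos by (simp add: abs_mult)
    also have "H ^ 3 * (binary_entropy (t h) - binary_entropy t0 + d * (t h - t0)) = ?a + d * h"
      using H_pos by (simp add: t_def local_target_def sqrt_n field_simps)
    finally show ?thesis by (simp add: abs_minus_commute algebra_simps)
  qed
  finally have "\<bar>- d * h - ?a\<bar> \<le> M * (H\<^sup>2 / H ^ 3)" .
  then have "(- d * h - ?a)\<^sup>2 \<le> (M * (H\<^sup>2 / H ^ 3))\<^sup>2"
    using power_mono[of "\<bar>- d * h - ?a\<bar>" _ 2] by simp
  also have "\<dots> = M\<^sup>2 / H\<^sup>2"
    using H_pos by (simp add: power2_eq_square power3_eq_cube)
  finally have bias: "(- d * h - ?a)\<^sup>2 \<le> M\<^sup>2 / H\<^sup>2" .
  have "d\<^sup>2 * (1 / c\<^sup>2 - (t h)\<^sup>2) \<le> d\<^sup>2 * (1 / c\<^sup>2 - t0\<^sup>2 + 2 / H\<^sup>2)"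
    using t_sq_close[OF h] by (intro mult_left_mono) auto
  also have "\<dots> \<le> d\<^sup>2 * (1 / c\<^sup>2 - t0\<^sup>2) + D\<^sup>2 * (2 / H\<^sup>2)"
    using d_bounds power_mono[of d D 2] H_pos by (simp add: distrib_left divide_right_mono)
  finally show "bexp n (c * t h)
      (\<lambda>ys. (- d * (real_of_int (sum_list ys) / (c * sqrt n) - sqrt n * t0) - ?a)\<^sup>2)
      \<le> d\<^sup>2 * (1 / c\<^sup>2 - t0\<^sup>2) + (2 * D\<^sup>2 + M\<^sup>2) / H\<^sup>2"
    unfolding t_def linear_estimator_risk[OF n c(1)] unfolding t_def[symmetric] using bias by (simp add: add_divide_distrib mult.commute)
qed (use c in auto)

text \<open>The reference overlap \<open>c0\<close> may exceed the overlap \<open>c\<close> of the experiment: the multiplier in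
  the van Trees bound is tuned to \<open>c0\<close>, which keeps the error term uniform as \<open>c\<close> tends to \<open>0\<close>.\<close>

lemma minimax_risk_lower_pos:
  assumes c: "0 < c" "c \<le> c0" and c0: "1 / 2 \<le> c0\<^sup>2" "c0 \<le> 1"
  shows "ereal (d\<^sup>2 * (1 / c0\<^sup>2 - t0\<^sup>2) - (4 * D * M + 16 * D\<^sup>2 / \<tau>\<^sup>2 + 40 * D\<^sup>2) / H\<^sup>2)
    \<le> minimax_risk n H t0 binary_entropy c"
proof (rule minimax_risk_geI, fold t_def)
  define x where "x = 1 / c0\<^sup>2 - t0\<^sup>2"
  have c0': "0 < c0\<^sup>2" "c0\<^sup>2 \<le> 1" "1 \<le> 1 / c0\<^sup>2" "1 / c0\<^sup>2 \<le> 2"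
    using c c0 by (auto simp: power_le_one field_simps)
  have "t0\<^sup>2 \<le> (1 - \<tau>) * 1"
    unfolding power2_eq_square using t0 \<tau> by (intro mult_mono) auto
  then have "\<tau> \<le> 1 - t0\<^sup>2"
    by simp
  also have "\<dots> \<le> x"
    using c0' unfolding x_def by simp
  finally have x1: "\<tau> \<le> x" .
  have x2: "x \<le> 2"
    using c0' zero_le_power2[of t0] unfolding x_def by linarith
  note x = x1 x2
  fix T r
  assume r: "\<And>h. h \<in> {- H..H} \<Longrightarrow>
    bexp n (c * t h) (\<lambda>ys. (T ys - local_target n t0 binary_entropy h)\<^sup>2) \<le> r"
  \<comment> \<open>With slope \<open>- d\<close> and information \<open>1 / x\<close>, the
    quadratic \<open>- 2 * \<mu> * d - \<mu>\<^sup>2 / x\<close> is largest at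
    \<open>\<mu> = - d * x\<close>, with value \<open>d\<^sup>2 * x\<close>. The two corrections
    account for the variation of the slope and of the information over the interval.\<close>
  have "2 * (d\<^sup>2 * x - 2 * D * M / H\<^sup>2) - (- d * x)\<^sup>2 * (1 / x + 4 / (\<tau>\<^sup>2 * H\<^sup>2)) - 10 * (- d * x)\<^sup>2 / H\<^sup>2 \<le> r"
  proof (rule van_Trees_bound[OF n H_pos, where c = c and ?t0.0 = t0, folded t_def, OF _ _ _ _ r])
    fix h assume h: "h \<in> {- H..H}"
    show "\<bar>c * t h\<bar> < 1"
      using h c c0 by (intro ct_small) auto
    have "(binary_entropy has_real_derivative - artanh (t h)) (at (t h))"
      using t_range[OF h] \<tau> by (intro DERIV_binary_entropy) auto
    moreover have "(t has_real_derivative 1 / sqrt n) (at h)"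
      unfolding t_def[abs_def] using n by (auto intro!: derivative_eq_intros simp: field_simps)
    ultimately have "((\<lambda>h. binary_entropy (t h)) has_real_derivative - artanh (t h) * (1 / sqrt n)) (at h)"
      by (rule DERIV_chain2)
    then show "(local_target n t0 binary_entropy has_real_derivative - artanh (t h)) (at h)"
      unfolding local_target_def[abs_def] t_def[symmetric]
      using n by (auto intro!: derivative_eq_intros simp: field_simps)
    have "\<bar>d - artanh (t h)\<bar> \<le> \<bar>t0 - t h\<bar> / (1 - (1 - \<tau> / 2)\<^sup>2)"
      using t_range[OF h] t0 \<tau> by (intro artanh_real_lipschitz) auto
    also have "\<dots> \<le> (1 / H\<^sup>2) / (1 - (1 - \<tau> / 2)\<^sup>2)"
      using local_step[OF h] curvature_bounds \<tau> by (intro divide_right_mono) (auto simp: t_def)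
    finally have "d - M / H\<^sup>2 \<le> artanh (t h)"
      by (simp add: abs_le_iff mult.commute)
    then have "(d * x) * (d - M / H\<^sup>2) \<le> (d * x) * artanh (t h)"
      using d_bounds x \<tau> by (intro mult_left_mono) auto
    moreover have "(d * x) * (M / H\<^sup>2) \<le> (D * 2) * (M / H\<^sup>2)"
      using d_bounds x \<tau> curvature_bounds by (intro mult_right_mono mult_mono) auto
    ultimately show "d\<^sup>2 * x - 2 * D * M / H\<^sup>2 \<le> - d * x * - artanh (t h)"
      by (simp add: algebra_simps power2_eq_square)
    define y where "y = 1 / c0\<^sup>2 - (t h)\<^sup>2"
    have "(t h)\<^sup>2 \<le> (1 - \<tau> / 2) * 1"
      unfolding power2_eq_square using t_range[OF h] \<tau> by (intro mult_mono) auto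
    then have "\<tau> / 2 \<le> 1 - (t h)\<^sup>2"
      by simp
    also have "\<dots> \<le> y"
      using c0' unfolding y_def by simp
    finally have y: "\<tau> / 2 \<le> y" .
    have c2: "c\<^sup>2 \<le> c0\<^sup>2"
      using c by (intro power_mono) auto
    \<comment> \<open>Here \<open>c \<le> c0\<close> enters: the information at overlap
      \<open>c\<close> is at most that at \<open>c0\<close>, however small \<open>c\<close>
      is.\<close>
    have "1 / c0\<^sup>2 \<le> 1 / c\<^sup>2"
      using c c2 by (intro divide_left_mono) auto
    then have "y \<le> 1 / c\<^sup>2 - (t h)\<^sup>2"
      by (simp add: y_def)
    then have "1 / (1 / c\<^sup>2 - (t h)\<^sup>2) \<le> 1 / y"
      using y \<tau> by (intro divide_left_mono) auto
    moreover have "c\<^sup>2 / (1 - (c * t h)\<^sup>2) = 1 / (1 / c\<^sup>2 - (t h)\<^sup>2)"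
      using c by (simp add: power_mult_distrib field_simps)
    moreover have "1 / y \<le> 1 / x + 4 / (\<tau>\<^sup>2 * H\<^sup>2)"
    proof -
      have "1 / y - 1 / x = (x - y) / (y * x)"
        using x y \<tau> by (simp add: field_simps)
      also have "\<dots> \<le> (2 / H\<^sup>2) / (\<tau> / 2 * \<tau>)"
        using t_sq_close[OF h] x y \<tau> by (intro frac_le mult_mono) (auto simp: x_def y_def)
      finally show ?thesis
        by (simp add: power2_eq_square ac_simps)
    qed
    ultimately show "c\<^sup>2 / (1 - (c * t h)\<^sup>2) \<le> 1 / x + 4 / (\<tau>\<^sup>2 * H\<^sup>2)"
      by linarith
  qed
  \<comment> \<open>As \<open>x \<le> 2\<close>, the squared multiplier is at most
    \<open>4 * D\<^sup>2\<close>; this produces the constants 16 and 40.\<close>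
  moreover have "(d * x)\<^sup>2 * (4 / (\<tau>\<^sup>2 * H\<^sup>2) + 10 / H\<^sup>2) \<le> (D * 2)\<^sup>2 * (4 / (\<tau>\<^sup>2 * H\<^sup>2) + 10 / H\<^sup>2)"
    using d_bounds x \<tau> by (intro mult_right_mono power_mono mult_mono) auto
  moreover have "2 * (d\<^sup>2 * x - 2 * D * M / H\<^sup>2) - (- d * x)\<^sup>2 * (1 / x + 4 / (\<tau>\<^sup>2 * H\<^sup>2)) - 10 * (- d * x)\<^sup>2 / H\<^sup>2
    = d\<^sup>2 * x - 4 * D * M / H\<^sup>2 - (d * x)\<^sup>2 * (4 / (\<tau>\<^sup>2 * H\<^sup>2) + 10 / H\<^sup>2)"
  proof -
    have "(d * x)\<^sup>2 * (1 / x) = d\<^sup>2 * x"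
      using x \<tau> by (simp add: power2_eq_square)
    then show ?thesis
      unfolding distrib_left by simp
  qed
  moreover have "(D * 2)\<^sup>2 * (4 / (\<tau>\<^sup>2 * H\<^sup>2) + 10 / H\<^sup>2) = 16 * D\<^sup>2 / \<tau>\<^sup>2 / H\<^sup>2 + 40 * D\<^sup>2 / H\<^sup>2"
    by (simp add: power2_eq_square algebra_simps)
  ultimately show "d\<^sup>2 * (1 / c0\<^sup>2 - t0\<^sup>2) - (4 * D * M + 16 * D\<^sup>2 / \<tau>\<^sup>2 + 40 * D\<^sup>2) / H\<^sup>2 \<le> r"
    unfolding x_def[symmetric] add_divide_distrib by linarith
qed (use c c0 ct_small[of _ c] in \<open>auto intro: less_imp_le\<close>)

text \<open>At \<open>c = 0\<close> the target decreases with slope at least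
  \<open>artanh (\<tau> / 2)\<close> in size, so a quarter of its squared range is at least
  \<open>H\<^sup>2 * (artanh (\<tau> / 2))\<^sup>2\<close>. By \<open>H'\<close> this exceeds
  \<open>2 * D\<^sup>2\<close>, a bound for the main term.\<close>

lemma minimax_risk_lower:
  assumes c: "0 \<le> c" "c \<le> c0" and c0: "1 / 2 \<le> c0\<^sup>2" "c0 \<le> 1"
    and H': "1 / H\<^sup>2 \<le> (artanh (\<tau> / 2))\<^sup>2 / (2 * D\<^sup>2)"
  shows "ereal (d\<^sup>2 * (1 / c0\<^sup>2 - t0\<^sup>2) - (4 * D * M + 16 * D\<^sup>2 / \<tau>\<^sup>2 + 40 * D\<^sup>2) / H\<^sup>2)
    \<le> minimax_risk n H t0 binary_entropy c"
proof (cases "c = 0")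
  case True
  let ?a = "local_target n t0 binary_entropy" and ?L = "artanh (\<tau> / 2)"
  have D: "0 < D" and L: "0 < ?L"
    using \<tau> by (auto intro!: artanh_real_pos)
  have bd: "\<bar>?a h\<bar> \<le> sqrt n" if h: "h \<in> {- H..H}" for h
  proof -
    have "\<bar>binary_entropy (t h) - binary_entropy t0\<bar> \<le> 1"
      using binary_entropy_bounds[of "t h"] binary_entropy_bounds[of t0] t_range[OF h] t0 \<tau> by auto
    then have "sqrt n * \<bar>binary_entropy (t h) - binary_entropy t0\<bar> \<le> sqrt n * 1"
      by (intro mult_left_mono) auto
    then show ?thesis by (simp add: local_target_def t_def abs_mult)
  qed
  obtain l u where lu: "minimax_risk n H t0 binary_entropy 0 = ereal ((u - l)\<^sup>2 / 4)"
    "\<And>h. h \<in> {- H..H} \<Longrightarrow> l \<le> ?a h \<and> ?a h \<le> u"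
    by (rule minimax_risk_zero[OF less_imp_le[OF H_pos] bd]) (assumption, rule that)
  have ends: "- H \<in> {- H..H}" "H \<in> {- H..H}"
    using H_pos by auto
  have "2 * H * ?L \<le> ?a (- H) - ?a H"
  proof -
    have less: "t (- H) < t H"
      using H_pos n by (simp add: t_def)
    have "\<exists>z. t (- H) < z \<and> z < t H \<and>
      binary_entropy (t H) - binary_entropy (t (- H)) = (t H - t (- H)) * - artanh z"
      using t_range[OF ends(1)] t_range[OF ends(2)] \<tau>
      by (intro MVT2[OF less] DERIV_binary_entropy) linarith+
    then obtain z where z: "t (- H) < z" "z < t H"
      "binary_entropy (t H) - binary_entropy (t (- H)) = (t H - t (- H)) * - artanh z"
      by (elim exE conjE)
    have "?L \<le> artanh z"
      using z t_range[OF ends(1)] t_range[OF ends(2)] \<tau> by (intro artanh_real_mono) auto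
    then have "2 * H * ?L \<le> 2 * H * artanh z"
      using H_pos by (intro mult_left_mono) auto
    also have "2 * H * artanh z = sqrt n * ((t H - t (- H)) * artanh z)"
      using n by (simp add: t_def field_simps)
    also have "\<dots> = ?a (- H) - ?a H"
    proof -
      have "?a (- H) - ?a H = - (sqrt n * (binary_entropy (t H) - binary_entropy (t (- H))))"
        by (simp add: local_target_def t_def right_diff_distrib)
      then show ?thesis
        unfolding z(3) by simp
    qed
    finally show ?thesis .
  qed
  also have "\<dots> \<le> u - l"
    using lu(2)[OF ends(1)] lu(2)[OF ends(2)] by linarith
  finally have "(2 * H * ?L)\<^sup>2 \<le> (u - l)\<^sup>2"
    using H_pos L by (intro power_mono) auto
  then have "H\<^sup>2 * ?L\<^sup>2 \<le> (u - l)\<^sup>2 / 4"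
    by (simp add: power_mult_distrib)
  moreover have "2 * D\<^sup>2 \<le> H\<^sup>2 * ?L\<^sup>2"
    using H' H_pos D by (simp add: field_simps)
  moreover have "d\<^sup>2 * (1 / c0\<^sup>2 - t0\<^sup>2) \<le> D\<^sup>2 * 2"
  proof (rule mult_mono)
    have "0 < c0\<^sup>2" using c0 by linarith
    then have "1 / c0\<^sup>2 \<le> 2" using c0 by (simp add: field_simps)
    then show "1 / c0\<^sup>2 - t0\<^sup>2 \<le> 2" using zero_le_power2[of t0] by linarith
    have "c0\<^sup>2 \<le> 1" "t0\<^sup>2 \<le> 1" using c c0 t0 \<tau> by (auto simp: power_le_one)
    moreover have "1 \<le> 1 / c0\<^sup>2" using \<open>0 < c0\<^sup>2\<close> \<open>c0\<^sup>2 \<le> 1\<close> by (simp add: field_simps)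
    ultimately show "0 \<le> 1 / c0\<^sup>2 - t0\<^sup>2" by linarith
  qed (use d_bounds in \<open>auto intro: power_mono\<close>)
  moreover have "0 \<le> (4 * D * M + 16 * D\<^sup>2 / \<tau>\<^sup>2 + 40 * D\<^sup>2) / H\<^sup>2"
    using D curvature_bounds by (intro divide_nonneg_nonneg add_nonneg_nonneg mult_nonneg_nonneg) auto
  ultimately show ?thesis
    unfolding True lu(1) ereal_less_eq by linarith
next
  case False
  then show ?thesis
    using minimax_risk_lower_pos[of c c0] c c0 by simp
qed

end

section \<open>Menu regret and menu frontier\<close>

lemma menus_nonempty:
  assumes "1 \<le> k"
  shows "menus k \<noteq> {}"
proof -
  have "{undefined} \<in> menus k"
    using assms by (simp add: menus_def)
  then show ?thesis by blast
qed

lemma great_circle_nonempty: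
  fixes p :: "real ^ 3"
  assumes "norm p = 1"
  shows "great_circle p \<noteq> {}"
  using orthonormal_frame[OF assms] by (fastforce simp: great_circle_def)

lemma inverse_cos_sq:
  fixes x :: real
  assumes "cos x \<noteq> 0"
  shows "1 / (cos x)\<^sup>2 = 1 + (tan x)\<^sup>2"
  using assms by (simp add: tan_def sin_squared_eq power_divide field_simps)

text \<open>For \<open>k \<ge> 2\<close> the angle is at most \<open>pi / 4\<close>. This supplies
  the condition \<open>1 / 2 \<le> c0\<^sup>2\<close> of the lower risk bound; for
  \<open>k = 1\<close> the cosine would vanish.\<close>

lemma cos_pi_over_ge:
  assumes "2 \<le> k"
  shows "0 < cos (pi / (2 * real k))" "1 / 2 \<le> (cos (pi / (2 * real k)))\<^sup>2"
proof -
  have "pi / (2 * real k) \<le> pi / 4"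
    using assms by (intro divide_left_mono) auto
  moreover have "pi / 4 \<le> pi" "0 \<le> pi / (2 * real k)"
    using pi_ge_zero by simp_all
  ultimately have c: "cos (pi / 4) \<le> cos (pi / (2 * real k))"
    by (intro cos_monotone_0_pi_le)
  have p: "0 < cos (pi / 4 :: real)"
    by (simp add: cos_45)
  then show "0 < cos (pi / (2 * real k))"
    using c by linarith
  have "(cos (pi / 4))\<^sup>2 \<le> (cos (pi / (2 * real k)))\<^sup>2"
    using c p by (intro power_mono) auto
  then show "1 / 2 \<le> (cos (pi / (2 * real k)))\<^sup>2"
    by (simp add: cos_45 power_divide)
qed

lemma tan_pi_over_sq_le_1:
  assumes "2 \<le> k"
  shows "(tan (pi / (2 * real k)))\<^sup>2 \<le> 1"
proof -
  have "1 / (cos (pi / (2 * real k)))\<^sup>2 \<le> 2"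
    using cos_pi_over_ge[OF assms] by (simp add: field_simps)
  then show ?thesis
    using inverse_cos_sq[of "pi / (2 * real k)"] cos_pi_over_ge[OF assms] by simp
qed

lemma menu_frontier_great_circle:
  fixes p :: "real ^ 3"
  assumes p: "norm p = 1" and k: "2 \<le> k"
  shows "menu_frontier (great_circle p) k t0 s = ereal ((deriv s t0)\<^sup>2 * (tan (pi / (2 * real k)))\<^sup>2)"
proof -
  let ?c = "cos (pi / (2 * real k))" and ?d2 = "(deriv s t0)\<^sup>2"
  let ?r = "\<lambda>x. ereal ?d2 * (inverse ((ereal x)\<^sup>2) - 1)"
  note c = cos_pi_over_ge[OF k]
  have pos: "?r x = ereal (?d2 * (1 / x\<^sup>2 - 1))" if "0 < x" for x
  proof -
    have "inverse ((ereal x)\<^sup>2) = ereal (1 / x\<^sup>2)"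
      using that by (simp add: power2_eq_square inverse_eq_divide)
    then show ?thesis
      by (simp add: one_ereal_def)
  qed
  have val: "ereal (?d2 * (tan (pi / (2 * real k)))\<^sup>2) = ?r ?c"
    using pos[OF c(1)] inverse_cos_sq[of "pi / (2 * real k)"] c by simp
  \<comment> \<open>Antitonicity in the overlap turns the two covering bounds into the exact value.
    At overlap \<open>0\<close> the factor is infinite; if the derivative vanishes as well, the
    product is \<open>0\<close>, as is the right-hand value.\<close>
  have anti: "?r y \<le> ?r x" if "0 \<le> x" "x \<le> y" "0 < y" for x y
  proof (cases "x = 0")
    case True
    then have "inverse ((ereal x)\<^sup>2) - 1 = \<infinity>"
      by (simp add: power2_eq_square one_ereal_def zero_ereal_def[symmetric])
    then show ?thesis
      using pos[OF that(3)] by (cases "deriv s t0 = 0") (auto simp: zero_ereal_def[symmetric])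
  next
    case False
    then have "1 / y\<^sup>2 \<le> 1 / x\<^sup>2"
      using that by (intro divide_left_mono power_mono) auto
    then show ?thesis
      using pos[of x] pos[OF that(3)] False that by (simp add: mult_left_mono)
  qed
  show ?thesis
    unfolding val menu_frontier_def
  proof (rule antisym)
    obtain V where V: "V \<in> menus k" "\<And>q. q \<in> great_circle p \<Longrightarrow> ?c \<le> menu_overlap V q"
      using exists_equispaced_menu[OF p, of k] k by auto
    show "(INF V\<in>menus k. SUP q\<in>great_circle p. ?r (menu_overlap V q)) \<le> ?r ?c"
      using V c by (intro INF_lower2[OF V(1)] SUP_least anti) (auto intro: less_le_trans)
    show "?r ?c \<le> (INF V\<in>menus k. SUP q\<in>great_circle p. ?r (menu_overlap V q))"
    proof (rule INF_greatest)
      fix V assume V: "V \<in> menus k"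
      obtain q where q: "q \<in> great_circle p" "menu_overlap V q \<le> ?c"
        using exists_poorly_covered_direction[OF p k V] by blast
      then show "?r ?c \<le> (SUP q\<in>great_circle p. ?r (menu_overlap V q))"
        using menu_overlap_bounds[OF V] c by (intro SUP_upper2[OF q(1)] anti) auto
    qed
  qed
qed

lemma menu_regret_crude_bounds:
  fixes p :: "real ^ 3"
  assumes p: "norm p = 1" and k: "1 \<le> k" and n: "0 < n" and H: "0 \<le> H"
    and range: "\<And>h. h \<in> {- H..H} \<Longrightarrow> t0 + h / sqrt (real n) \<in> {0..1}"
    and s: "\<And>t. t \<in> {0..1} \<Longrightarrow> 0 \<le> s t \<and> s t \<le> 1"
  shows "ereal (- real n) \<le> menu_regret (great_circle p) n k H t0 s"
    "menu_regret (great_circle p) n k H t0 s \<le> ereal (real n)"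
proof -
  have crude: "0 \<le> minimax_risk n H t0 s c \<and> minimax_risk n H t0 s c \<le> ereal n" if "0 \<le> c" "c \<le> 1" for c
    using minimax_risk_crude_bounds[of n H c t0 s] n H range s that by blast
  have diff: "ereal (- real n) \<le> minimax_risk n H t0 s c - minimax_risk n H t0 s 1
      \<and> minimax_risk n H t0 s c - minimax_risk n H t0 s 1 \<le> ereal n" if "0 \<le> c" "c \<le> 1" for c
    using crude[OF that] crude[of 1]
    by (cases "minimax_risk n H t0 s c"; cases "minimax_risk n H t0 s 1") auto
  have bd: "ereal (- real n) \<le> (SUP q\<in>great_circle p. minimax_risk n H t0 s (menu_overlap V q) - minimax_risk n H t0 s 1)"
    "(SUP q\<in>great_circle p. minimax_risk n H t0 s (menu_overlap V q) - minimax_risk n H t0 s 1) \<le> ereal n"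
    if V: "V \<in> menus k" for V
  proof -
    obtain q where q: "q \<in> great_circle p"
      using great_circle_nonempty[OF p] by blast
    show "ereal (- real n) \<le> (SUP q\<in>great_circle p. minimax_risk n H t0 s (menu_overlap V q) - minimax_risk n H t0 s 1)"
      using diff menu_overlap_bounds[OF V] by (intro SUP_upper2[OF q]) auto
    show "(SUP q\<in>great_circle p. minimax_risk n H t0 s (menu_overlap V q) - minimax_risk n H t0 s 1) \<le> ereal n"
      using diff menu_overlap_bounds[OF V] by (intro SUP_least) auto
  qed
  obtain V where V: "V \<in> menus k"
    using menus_nonempty[OF k] by blast
  show "ereal (- real n) \<le> menu_regret (great_circle p) n k H t0 s"
    unfolding menu_regret_def by (rule INF_greatest) (rule bd)
  show "menu_regret (great_circle p) n k H t0 s \<le> ereal (real n)"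
    unfolding menu_regret_def by (rule INF_lower2[OF V]) (rule bd(2)[OF V])
qed

lemma ereal_abs_diff_leI:
  assumes "ereal (x - y) \<le> f" "f \<le> ereal (x + y)"
  shows "\<bar>f - ereal x\<bar> \<le> ereal y"
  using assms by (cases f) auto

text \<open>\<open>upper_error\<close> and \<open>lower_error\<close> repeat, outside the locale,
  the coefficients of \<open>1 / H\<^sup>2\<close> in the two risk bounds, to show that they depend
  on \<open>\<tau>\<close> only.\<close>

definition upper_error :: "real \<Rightarrow> real" where
  "upper_error \<tau> = 2 * (artanh (1 - \<tau>))\<^sup>2 + (1 / (1 - (1 - \<tau> / 2)\<^sup>2))\<^sup>2"

definition lower_error :: "real \<Rightarrow> real" where
  "lower_error \<tau> = 4 * artanh (1 - \<tau>) * (1 / (1 - (1 - \<tau> / 2)\<^sup>2))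
    + 16 * (artanh (1 - \<tau>))\<^sup>2 / \<tau>\<^sup>2 + 40 * (artanh (1 - \<tau>))\<^sup>2"

context entropy_experiment
begin

text \<open>Subtracting the risk at overlap \<open>1\<close> pairs each bound with the opposite one:
  the upper bound on the regret uses \<open>lo1\<close>, the lower one \<open>up1\<close>, so the
  errors add. The two together also make that risk finite, so the subtraction is meaningful.\<close>

lemma menu_regret_approx:
  fixes p :: "real ^ 3"
  assumes p: "norm p = 1" and k: "2 \<le> k"
    and H': "1 / H\<^sup>2 \<le> (artanh (\<tau> / 2))\<^sup>2 / (2 * D\<^sup>2)"
  shows "\<bar>menu_regret (great_circle p) n k H t0 binary_entropy - ereal (d\<^sup>2 * (tan (pi / (2 * real k)))\<^sup>2)\<bar>
    \<le> ereal ((upper_error \<tau> + lower_error \<tau>) / H\<^sup>2)"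
proof -
  let ?c = "cos (pi / (2 * real k))" and ?R = "minimax_risk n H t0 binary_entropy"
  note c = cos_pi_over_ge[OF k]
  have tan: "d\<^sup>2 * (tan (pi / (2 * real k)))\<^sup>2 = d\<^sup>2 * (1 / ?c\<^sup>2 - t0\<^sup>2) - d\<^sup>2 * (1 - t0\<^sup>2)"
    using inverse_cos_sq[of "pi / (2 * real k)"] c by (simp add: algebra_simps)
  have lo1: "ereal (d\<^sup>2 * (1 - t0\<^sup>2) - lower_error \<tau> / H\<^sup>2) \<le> ?R 1"
    using minimax_risk_lower[of 1 1, OF _ _ _ _ H'] by (simp add: lower_error_def)
  have up1: "?R 1 \<le> ereal (d\<^sup>2 * (1 - t0\<^sup>2) + upper_error \<tau> / H\<^sup>2)"
    using minimax_risk_upper[of 1] by (simp add: upper_error_def)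
  obtain r where r: "?R 1 = ereal r"
    using lo1 up1 by (cases "?R 1") auto
  show ?thesis
  proof (rule ereal_abs_diff_leI)
    obtain V where V: "V \<in> menus k" "\<And>q. q \<in> great_circle p \<Longrightarrow> ?c \<le> menu_overlap V q"
      using exists_equispaced_menu[OF p, of k] k by auto
    show "menu_regret (great_circle p) n k H t0 binary_entropy
      \<le> ereal (d\<^sup>2 * (tan (pi / (2 * real k)))\<^sup>2 + (upper_error \<tau> + lower_error \<tau>) / H\<^sup>2)"
      unfolding menu_regret_def
    proof (intro INF_lower2[OF V(1)] SUP_least)
      fix q assume q: "q \<in> great_circle p"
      let ?m = "menu_overlap V q"
      have m: "?c \<le> ?m" "0 < ?m" "?m \<le> 1"
        using V(2)[OF q] c menu_overlap_bounds[OF V(1)] by (auto intro: less_le_trans)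
      have "1 / ?m\<^sup>2 \<le> 1 / ?c\<^sup>2"
        using m c by (intro divide_left_mono power_mono) auto
      then have "d\<^sup>2 * (1 / ?m\<^sup>2 - t0\<^sup>2) \<le> d\<^sup>2 * (1 / ?c\<^sup>2 - t0\<^sup>2)"
        by (intro mult_left_mono) auto
      then have "?R ?m \<le> ereal (d\<^sup>2 * (1 / ?c\<^sup>2 - t0\<^sup>2) + upper_error \<tau> / H\<^sup>2)"
        using minimax_risk_upper[OF m(2,3)] by (auto simp: upper_error_def intro: order.trans)
      then show "?R ?m - ?R 1 \<le> ereal (d\<^sup>2 * (tan (pi / (2 * real k)))\<^sup>2 + (upper_error \<tau> + lower_error \<tau>) / H\<^sup>2)"
        using lo1 unfolding tan r by (cases "?R ?m") (auto simp: add_divide_distrib)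
    qed
    show "ereal (d\<^sup>2 * (tan (pi / (2 * real k)))\<^sup>2 - (upper_error \<tau> + lower_error \<tau>) / H\<^sup>2)
      \<le> menu_regret (great_circle p) n k H t0 binary_entropy"
      unfolding menu_regret_def
    proof (rule INF_greatest)
      fix V assume V: "V \<in> menus k"
      obtain q where q: "q \<in> great_circle p" "menu_overlap V q \<le> ?c"
        using exists_poorly_covered_direction[OF p k V] by blast
      have "ereal (d\<^sup>2 * (1 / ?c\<^sup>2 - t0\<^sup>2) - lower_error \<tau> / H\<^sup>2) \<le> ?R (menu_overlap V q)"
        unfolding lower_error_def
        using menu_overlap_bounds[OF V] q c by (intro minimax_risk_lower H') auto
      then have "ereal (d\<^sup>2 * (tan (pi / (2 * real k)))\<^sup>2 - (upper_error \<tau> + lower_error \<tau>) / H\<^sup>2)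
        \<le> ?R (menu_overlap V q) - ?R 1"
        using up1 unfolding tan r by (cases "?R (menu_overlap V q)") (auto simp: add_divide_distrib)
      then show "ereal (d\<^sup>2 * (tan (pi / (2 * real k)))\<^sup>2 - (upper_error \<tau> + lower_error \<tau>) / H\<^sup>2)
        \<le> (SUP q\<in>great_circle p. ?R (menu_overlap V q) - ?R 1)"
        by (rule SUP_upper2[OF q(1)])
    qed
  qed
qed

end

section \<open>Asymptotics\<close>

lemma powr_third_sq:
  fixes x :: real
  assumes "0 < x"
  shows "1 / (x powr (1 / 6))\<^sup>2 = x powr (- 1 / 3)" "(x powr (- 1 / 3)) ^ 3 = 1 / x"
proof -
  have "(x powr (1 / 6))\<^sup>2 = x powr (real 2 * (1 / 6))"
    by (rule powr_power) (use assms in simp)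
  then show "1 / (x powr (1 / 6))\<^sup>2 = x powr (- 1 / 3)"
    using powr_minus_divide[of x "1 / 3"] by simp
  have "(x powr (- 1 / 3)) ^ 3 = x powr (real 3 * (- 1 / 3))"
    by (rule powr_power) (use assms in simp)
  then show "(x powr (- 1 / 3)) ^ 3 = 1 / x"
    using powr_minus_divide[of x 1] assms by simp
qed

lemma menu_regret_entropy_approx:
  fixes \<tau> :: real
  assumes \<tau>: "0 < \<tau>" "\<tau> < 1 / 2"
  obtains C :: real where "0 \<le> C"
    "\<And>(p :: real ^ 3) k n t0. norm p = 1 \<Longrightarrow> 2 \<le> k \<Longrightarrow> 1 \<le> n \<Longrightarrow> t0 \<in> {\<tau>..1 - \<tau>} \<Longrightarrow>
      (\<forall>h\<in>{- (real n powr (1/6))..real n powr (1/6)}. t0 + h / sqrt (real n) \<in> {0..1}) \<Longrightarrow>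
      \<bar>menu_regret (great_circle p) n k (real n powr (1/6)) t0 binary_entropy
        - ereal ((artanh t0)\<^sup>2 * (tan (pi / (2 * real k)))\<^sup>2)\<bar> \<le> ereal (C * real n powr (- 1/3))"
proof
  let ?D = "artanh (1 - \<tau>)" and ?K = "upper_error \<tau> + lower_error \<tau>"
  define \<epsilon> where "\<epsilon> = min (\<tau> / 2) ((artanh (\<tau> / 2))\<^sup>2 / (2 * ?D\<^sup>2))"
  \<comment> \<open>The first summand serves \<open>\<delta> \<le> \<epsilon>\<close>. Otherwise
    \<open>n \<le> (1 / \<epsilon>) ^ 3\<close>, regret and main term differ by at most
    \<open>(1 / \<epsilon>) ^ 3 + ?D\<^sup>2\<close>, and dividing by \<open>\<epsilon>\<close>
    compensates the factor \<open>\<delta> > \<epsilon>\<close>.\<close>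
  define C where "C = \<bar>?K\<bar> + ((1 / \<epsilon>) ^ 3 + ?D\<^sup>2) / \<epsilon>"
  have D: "0 < ?D" "0 < artanh (\<tau> / 2)"
    using \<tau> by (auto intro!: artanh_real_pos)
  then have \<epsilon>: "0 < \<epsilon>"
    using \<tau> by (simp add: \<epsilon>_def)
  show "0 \<le> C"
    using \<epsilon> by (simp add: C_def)
  fix p :: "real ^ 3" and k n :: nat and t0 :: real
  assume p: "norm p = 1" and k: "2 \<le> k" and n: "1 \<le> n" and t0: "t0 \<in> {\<tau>..1 - \<tau>}"
    and range: "\<forall>h\<in>{- (real n powr (1/6))..real n powr (1/6)}. t0 + h / sqrt (real n) \<in> {0..1}"
  let ?F = "menu_regret (great_circle p) n k (real n powr (1/6)) t0 binary_entropy"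
    and ?A = "(artanh t0)\<^sup>2 * (tan (pi / (2 * real k)))\<^sup>2"
  define \<delta> where "\<delta> = real n powr (- 1/3)"
  have \<delta>: "0 < \<delta>" "1 / (real n powr (1/6))\<^sup>2 = \<delta>" "\<delta> ^ 3 = 1 / real n"
    using n powr_third_sq[of "real n"] by (auto simp: \<delta>_def)
  show "\<bar>?F - ereal ?A\<bar> \<le> ereal (C * real n powr (- 1/3))"
  proof (cases "\<delta> \<le> \<epsilon>")
    case True
    interpret entropy_experiment \<tau> t0 "real n powr (1/6)" n
      using \<tau> t0 n True \<delta> by unfold_locales (auto simp: \<epsilon>_def)
    have "\<bar>?F - ereal ?A\<bar> \<le> ereal (?K / (real n powr (1/6))\<^sup>2)"
      using menu_regret_approx[OF p k] True \<delta> by (simp add: \<epsilon>_def)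
    also have "?K / (real n powr (1/6))\<^sup>2 = ?K * \<delta>"
      unfolding \<delta>(2)[symmetric] by simp
    also have "ereal (?K * \<delta>) \<le> ereal (C * \<delta>)"
    proof -
      have "?K \<le> C"
        using \<epsilon> abs_ge_self[of ?K] by (simp add: C_def add_increasing2)
      then show ?thesis
        using \<delta>(1) by (simp add: mult_right_mono)
    qed
    finally show ?thesis
      by (simp add: \<delta>_def)
  next
    case False
    have F: "ereal (- real n) \<le> ?F" "?F \<le> ereal (real n)"
      using menu_regret_crude_bounds[OF p, of k n "real n powr (1/6)" t0 binary_entropy]
        k n range binary_entropy_bounds by auto
    have "?A \<le> ?D\<^sup>2 * 1"
    proof (rule mult_mono)
      show "(artanh t0)\<^sup>2 \<le> ?D\<^sup>2"
        using \<tau> t0 artanh_real_pos[of t0] by (intro power_mono artanh_real_mono) auto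
    qed (use tan_pi_over_sq_le_1[OF k] in auto)
    then have A: "0 \<le> ?A" "?A \<le> ?D\<^sup>2"
      by auto
    have "\<epsilon> ^ 3 \<le> \<delta> ^ 3"
      using False \<epsilon> by (intro power_mono) auto
    then have "real n \<le> (1 / \<epsilon>) ^ 3"
      unfolding \<delta>(3) using n \<epsilon> by (simp add: power_divide field_simps)
    moreover have "(1 / \<epsilon>) ^ 3 + ?D\<^sup>2 \<le> ((1 / \<epsilon>) ^ 3 + ?D\<^sup>2) / \<epsilon> * \<delta>"
    proof -
      have "((1 / \<epsilon>) ^ 3 + ?D\<^sup>2) / \<epsilon> * \<epsilon> \<le> ((1 / \<epsilon>) ^ 3 + ?D\<^sup>2) / \<epsilon> * \<delta>"
        using False \<epsilon> by (intro mult_left_mono) auto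
      then show ?thesis using \<epsilon> by simp
    qed
    moreover have "((1 / \<epsilon>) ^ 3 + ?D\<^sup>2) / \<epsilon> * \<delta> \<le> C * \<delta>"
      using \<delta>(1) by (intro mult_right_mono) (auto simp: C_def)
    ultimately have "real n + ?D\<^sup>2 \<le> C * \<delta>"
      by linarith
    moreover have "\<bar>?F - ereal ?A\<bar> \<le> ereal (real n + ?D\<^sup>2)"
    proof (rule ereal_abs_diff_leI)
      have "ereal (?A - (real n + ?D\<^sup>2)) \<le> ereal (- real n)"
        unfolding ereal_less_eq using A by linarith
      then show "ereal (?A - (real n + ?D\<^sup>2)) \<le> ?F"
        using F(1) by (rule order.trans)
      have "ereal (real n) \<le> ereal (?A + (real n + ?D\<^sup>2))"
        unfolding ereal_less_eq using A zero_le_power2[of ?D] by linarith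
      with F(2) show "?F \<le> ereal (?A + (real n + ?D\<^sup>2))"
        by (rule order.trans)
    qed
    ultimately show ?thesis
      unfolding \<delta>_def by (meson ereal_less_eq(3) order.trans)
  qed
qed

theorem theorem5p5:
  fixes \<tau> :: real
  assumes "0 < \<tau>" and "\<tau> < 1 / 2"
  shows "(\<exists>C :: real. \<forall>p :: real ^ 3. norm p = 1 \<longrightarrow>
      (\<forall>k :: nat \<Rightarrow> nat. (\<forall>n. 2 \<le> k n) \<longrightarrow>
        (\<forall>n \<ge> 1. \<forall>t0 \<in> {\<tau>..1 - \<tau>}.
          (\<forall>h \<in> {- (real n powr (1/6))..real n powr (1/6)}.
            t0 + h / sqrt (real n) \<in> {0..1}) \<longrightarrow>
          \<bar>menu_regret (great_circle p) n (k n) (real n powr (1/6)) t0 binary_entropy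
            - ereal ((artanh t0)\<^sup>2 * (tan (pi / (2 * real (k n))))\<^sup>2)\<bar>
          \<le> ereal (C * real n powr (- 1/3)))))
    \<and> (\<forall>p :: real ^ 3. norm p = 1 \<longrightarrow>
      (\<forall>t0 \<in> {\<tau>..1 - \<tau>}. \<forall>k :: nat \<Rightarrow> nat. (\<forall>n. 2 \<le> k n) \<longrightarrow>
        filterlim k at_top sequentially \<longrightarrow>
        (\<lambda>n. real (k n)) \<in> o(\<lambda>n. real n powr (1/6)) \<longrightarrow>
        (\<lambda>n. menu_regret (great_circle p) n (k n) (real n powr (1/6)) t0 binary_entropy
          / menu_frontier (great_circle p) (k n) t0 binary_entropy) \<longlonglongrightarrow> 1))"
proof -
  obtain C :: real where C: "0 \<le> C"
    "\<And>(p :: real ^ 3) k n t0. norm p = 1 \<Longrightarrow> 2 \<le> k \<Longrightarrow> 1 \<le> n \<Longrightarrow> t0 \<in> {\<tau>..1 - \<tau>} \<Longrightarrow>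
      (\<forall>h\<in>{- (real n powr (1/6))..real n powr (1/6)}. t0 + h / sqrt (real n) \<in> {0..1}) \<Longrightarrow>
      \<bar>menu_regret (great_circle p) n k (real n powr (1/6)) t0 binary_entropy
        - ereal ((artanh t0)\<^sup>2 * (tan (pi / (2 * real k)))\<^sup>2)\<bar> \<le> ereal (C * real n powr (- 1/3))"
    by (rule menu_regret_entropy_approx[OF assms]) (rule that)
  have limit: "(\<lambda>n. menu_regret (great_circle p) n (k n) (real n powr (1/6)) t0 binary_entropy
          / menu_frontier (great_circle p) (k n) t0 binary_entropy) \<longlonglongrightarrow> 1"
    if p: "norm p = 1" and t0_mem: "t0 \<in> {\<tau>..1 - \<tau>}" and k: "\<And>n. 2 \<le> k n"
      and small: "(\<lambda>n. real (k n)) \<in> o(\<lambda>n. real n powr (1/6))"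
    for p :: "real ^ 3" and t0 and k :: "nat \<Rightarrow> nat"
  proof -
    define d where "d = artanh t0"
    have d: "0 < d"
      unfolding d_def using t0_mem assms by (intro artanh_real_pos) auto
    define F where "F n = menu_regret (great_circle p) n (k n) (real n powr (1/6)) t0 binary_entropy" for n
    define A where "A n = d\<^sup>2 * (tan (pi / (2 * real (k n))))\<^sup>2" for n
    have "deriv binary_entropy t0 = - d"
      unfolding d_def using t0_mem assms by (intro DERIV_imp_deriv DERIV_binary_entropy) auto
    then have frontier: "menu_frontier (great_circle p) (k n) t0 binary_entropy = ereal (A n)" for n
      by (simp add: menu_frontier_great_circle[OF p k] A_def)
    \<comment> \<open>From \<open>\<bar>tan x\<bar> \<ge> \<bar>x\<bar>\<close> and
      \<open>pi / 2 \<ge> 1\<close>: the frontier decays no faster than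
      \<open>1 / k ^ 2\<close>.\<close>
    have A: "d\<^sup>2 / (real (k n))\<^sup>2 \<le> A n" for n
    proof -
      have kn: "2 \<le> real (k n)"
        using k[of n] by simp
      have "pi / (2 * real (k n)) \<le> pi / 4"
        using kn by (intro divide_left_mono) auto
      then have x: "pi / (2 * real (k n)) < pi / 2"
        using pi_gt_zero by linarith
      have "1 / real (k n) \<le> pi / (2 * real (k n))"
        using kn pi_ge_two by (simp add: field_simps)
      also have "\<dots> \<le> \<bar>tan (pi / (2 * real (k n)))\<bar>"
        using abs_tan_ge[of "pi / (2 * real (k n))"] x by simp
      finally have "(1 / real (k n))\<^sup>2 \<le> (tan (pi / (2 * real (k n))))\<^sup>2"
        using power_mono[of "1 / real (k n)" "\<bar>tan (pi / (2 * real (k n)))\<bar>" 2] by simp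
      then have "d\<^sup>2 * (1 / real (k n))\<^sup>2 \<le> A n"
        unfolding A_def by (intro mult_left_mono) auto
      then show ?thesis
        by (simp add: power_divide)
    qed
    have A_pos: "0 < A n" for n
    proof -
      have "0 < d\<^sup>2 / (real (k n))\<^sup>2"
        using d k[of n] by simp
      then show ?thesis using A[of n] by linarith
    qed
    \<comment> \<open>Dividing the absolute error by the frontier bound gives
      \<open>k ^ 2 * n powr (- 1/3)\<close>, the square of the quotient that the little-o hypothesis
      sends to \<open>0\<close>.\<close>
    have ratio: "\<bar>real_of_ereal (F n) / A n - 1\<bar> \<le> C / d\<^sup>2 * (real (k n) / real n powr (1/6))\<^sup>2
        \<and> F n / ereal (A n) = ereal (real_of_ereal (F n) / A n)"
      if n1: "1 \<le> n" and big: "real n powr (- 1/3) \<le> \<tau> / 2" for n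
    proof -
      have \<delta>: "1 / (real n powr (1/6))\<^sup>2 = real n powr (- 1/3)"
        using n1 by (intro powr_third_sq) simp
      have H_large: "1 / (real n powr (1/6))\<^sup>2 \<le> \<tau> / 2"
        unfolding \<delta> by (rule big)
      have "0 < n"
        using n1 by simp
      interpret entropy_experiment \<tau> t0 "real n powr (1/6)" n
        by (rule entropy_experiment.intro[OF assms t0_mem \<open>0 < n\<close> refl H_large])
      \<comment> \<open>For such \<open>n\<close> the range condition of the uniform estimate holds
        automatically, by \<open>t_range\<close>.\<close>
      have range: "\<forall>h\<in>{- (real n powr (1/6))..real n powr (1/6)}. t0 + h / sqrt (real n) \<in> {0..1}"
      proof
        fix h assume h: "h \<in> {- (real n powr (1/6))..real n powr (1/6)}"
        have "0 \<le> t h" "t h \<le> 1"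
          using t_range[OF h] assms by linarith+
        then show "t0 + h / sqrt (real n) \<in> {0..1}"
          unfolding t_def atLeastAtMost_iff by blast
      qed
      have approx: "\<bar>F n - ereal (A n)\<bar> \<le> ereal (C * real n powr (- 1/3))"
        unfolding F_def A_def d_def by (rule C(2)[OF p k n1 t0_mem range])
      then obtain f where f: "F n = ereal f"
        by (cases "F n") auto
      then have "\<bar>f - A n\<bar> \<le> C * real n powr (- 1/3)"
        using approx by simp
      then have "\<bar>f - A n\<bar> / A n \<le> (C * real n powr (- 1/3)) / (d\<^sup>2 / (real (k n))\<^sup>2)"
        using A A_pos d C(1) k[of n] by (intro frac_le) auto
      also have "\<dots> = C / d\<^sup>2 * (real (k n) / real n powr (1/6))\<^sup>2"
        unfolding \<delta>[symmetric] by (simp add: power_divide)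
      also have "\<bar>f - A n\<bar> / A n = \<bar>f / A n - 1\<bar>"
      proof -
        have "f / A n - 1 = (f - A n) / A n"
          using A_pos[of n] by (simp add: diff_divide_distrib)
        then show ?thesis
          using A_pos[of n] by (simp only: abs_divide abs_of_pos)
      qed
      finally show ?thesis
        using A_pos[of n] by (simp add: f)
    qed
    have "((\<lambda>n. real n powr (- 1/3)) \<longlongrightarrow> 0) sequentially"
      by (rule tendsto_neg_powr) (auto intro: filterlim_real_sequentially)
    then have "eventually (\<lambda>n. real n powr (- 1/3) < \<tau> / 2) sequentially"
      by (rule order_tendstoD) (use assms in simp)
    then have ev: "eventually (\<lambda>n. \<bar>real_of_ereal (F n) / A n - 1\<bar> \<le> C / d\<^sup>2 * (real (k n) / real n powr (1/6))\<^sup>2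
        \<and> F n / ereal (A n) = ereal (real_of_ereal (F n) / A n)) sequentially"
      using eventually_ge_at_top[of 1] by eventually_elim (rule ratio, auto)
    have "(\<lambda>n. C / d\<^sup>2 * (real (k n) / real n powr (1/6))\<^sup>2) \<longlonglongrightarrow> C / d\<^sup>2 * 0\<^sup>2"
      by (intro tendsto_intros smalloD_tendsto[OF small])
    then have "(\<lambda>n. C / d\<^sup>2 * (real (k n) / real n powr (1/6))\<^sup>2) \<longlonglongrightarrow> 0"
      by simp
    then have "(\<lambda>n. real_of_ereal (F n) / A n - 1) \<longlonglongrightarrow> 0"
      by (rule Lim_null_comparison[rotated]) (use ev in \<open>auto elim: eventually_mono\<close>)
    then have "(\<lambda>n. ereal (real_of_ereal (F n) / A n)) \<longlonglongrightarrow> ereal 1"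
      unfolding lim_ereal by (simp add: LIM_zero_iff)
    \<comment> \<open>The extended and real quotients are identified only eventually, where the
      estimate has shown \<open>F n\<close> to be finite.\<close>
    then have "(\<lambda>n. F n / ereal (A n)) \<longlonglongrightarrow> 1"
      unfolding one_ereal_def
      by (rule Lim_transform_eventually) (use ev in \<open>auto elim: eventually_mono\<close>)
    then show ?thesis
      unfolding F_def frontier .
  qed
  show ?thesis
    using C(2) limit by blast
qed

end
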